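(* Let $n\ge1$. Two elements $q^n+\sum_{m=1}^{n-1}q^mb_m$ and $q^n+\sum_{m=1}^{n-1}q^mc_m$ of $\mathcal N_n$ lie in the same $\Gamma_{\mathrm{univ}}$-orbit if and only if there exists $\eta\in\mathbb H^\times$ such that $$c_m=\eta b_m\eta^{-1}\qquad(m=1,\dots,n-1).$$ Moreover, the group acting on $\mathcal N_n$ in this way (by simultaneous conjugation of the intermediate coefficients) is $\mathbb H^\times/\mathbb R^\times\simeq SO(3)$.
   Context: $\mathbb H$ denotes the quaternions, $\mathbb H^\times=\mathbb H\smallsetminus\{0\}$, $\mathbb S=\{q\in\mathbb H: q^2=-1\}$. Fix $i,j\in\mathbb S$ with $ij=-ji$, and put $\mathbb C:=\mathbb R+\mathbb R i\subset\mathbb H$. Let $\Omega\subset\mathbb H$ be a symmetric slice domain: a domain with $\Omega\cap\mathbb R\ne\emptyset$, with $\Omega_I:=\Omega\cap(\mathbb R+\mathbb R I)$ a domain for all $I\in\mathbb S$, and such that $x+yI\in\Omega$ implies $x+yI'\in\Omega$ for all $I,I'\in\mathbb S$. $f:\Omega\to\mathbb H$ is slice regular if for every $I\in\mathbb S$ one has $\frac12(\partial_x+I\partial_y)f(x+yI)=0$ on $\Omega_I$; $\mathrm{SR}(\Omega,\mathbb H)$ is the set of such functions. Polynomials $\sum_m q^ma_m$ with right coefficients are slice regular. For $f\in\mathrm{SR}(\Omega,\mathbb H)$ write $f(z)=g(z)+h(z)j$ on $\Omega_i$ with $g,h:\Omega_i\to\mathbb C$ holomorphic, put $\hat g(z)=\overline{g(\overline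 z)}$, $\hat h(z)=\overline{h(\overline z)}$, and $\Phi_f(z)=\begin{pmatrix} g(z) & -\hat h(z) \\ h(z) & \hat g(z) \end{pmatrix}$. Let $\mathcal B_{\mathbb H}$ be the group of matrices $T=\begin{pmatrix} A & 0 \\ C & D \end{pmatrix}\in\mathrm{GL}(4,\mathbb C)$ whose $2\times2$ blocks $A,C,D$ have the form $\begin{pmatrix} z & -\overline w \\ w & \overline z \end{pmatrix}$, and $\Gamma_{\mathrm{univ}}:=\mathcal B_{\mathbb H}/\mathbb R^\times$. It acts on $\mathrm{SR}(\Omega,\mathbb H)$ by letting $[T]^*f$ be the unique slice-regular function with $\Phi_{[T]^*f}=(C+D\Phi_f)A^{-1}$. $\mathcal N_n:=\{q^n+\sum_{m=1}^{n-1}q^mb_m: b_m\in\mathbb H\}$ is the set of monic slice-regular polynomials of degree $n$ with vanishing constant term. *)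

theory Defs
  imports "HOL-Analysis.Analysis" "HOL-Algebra.Group_Action"
begin

datatype quat = Quat (qr: real) (qi: real) (qj: real) (qk: real)

lemma quat_eq_iff: "p = q \<longleftrightarrow> qr p = qr q \<and> qi p = qi q \<and> qj p = qj q \<and> qk p = qk q"
  by (cases p; cases q) simp

instantiation quat :: real_vector
begin

definition "0 = Quat 0 0 0 0"
definition "p + q = Quat (qr p + qr q) (qi p + qi q) (qj p + qj q) (qk p + qk q)"
definition "p - q = Quat (qr p - qr q) (qi p - qi q) (qj p - qj q) (qk p - qk q)"
definition "- p = Quat (- qr p) (- qi p) (- qj p) (- qk p)"
definition "a *\<^sub>R p = Quat (a * qr p) (a * qi p) (a * qj p) (a * qk p)"
instance
  by standard (simp_all add: quat_eq_iff plus_quat_def zero_quat_def uminus_quat_def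
      minus_quat_def scaleR_quat_def algebra_simps)

end

instantiation quat :: real_inner
begin

definition "inner p q = qr p * qr q + qi p * qi q + qj p * qj q + qk p * qk q"
definition "norm (p::quat) = sqrt (inner p p)"
definition "sgn (p::quat) = p /\<^sub>R norm p"
definition "dist (p::quat) q = norm (p - q)"
definition "(uniformity :: (quat \<times> quat) filter) = (INF e\<in>{0<..}. principal {(x, y). dist x y < e})"
definition "open (U :: quat set) \<longleftrightarrow> (\<forall>x\<in>U. \<forall>\<^sub>F (x', y) in uniformity. x' = x \<longrightarrow> y \<in> U)"

instance
proof
  fix p q s :: quat and a :: real
  show "inner p q = inner q p" "inner (p + q) s = inner p s + inner q s"
    "inner (a *\<^sub>R p) q = a * inner p q" "0 \<le> inner p p"
    by (simp_all add: inner_quat_def plus_quat_def scaleR_quat_def algebra_simps)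
  have "inner p p = (qr p)\<^sup>2 + (qi p)\<^sup>2 + (qj p)\<^sup>2 + (qk p)\<^sup>2"
    by (simp add: inner_quat_def power2_eq_square)
  then show "inner p p = 0 \<longleftrightarrow> p = 0"
    by (simp add: quat_eq_iff zero_quat_def add_nonneg_eq_0_iff)
qed (simp_all add: norm_quat_def sgn_quat_def dist_quat_def uniformity_quat_def open_quat_def)

end

instantiation quat :: real_normed_div_algebra
begin

definition "1 = Quat 1 0 0 0"
definition "p * q = Quat
  (qr p * qr q - qi p * qi q - qj p * qj q - qk p * qk q)
  (qr p * qi q + qi p * qr q + qj p * qk q - qk p * qj q)
  (qr p * qj q - qi p * qk q + qj p * qr q + qk p * qi q)
  (qr p * qk q + qi p * qj q - qj p * qi q + qk p * qr q)"
definition "inverse p = Quat (qr p) (- qi p) (- qj p) (- qk p) /\<^sub>R inner p p"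
definition "p div q = p * inverse (q::quat)"

instance
proof
  fix p q s :: quat and a :: real
  note defs = quat_eq_iff plus_quat_def zero_quat_def one_quat_def times_quat_def scaleR_quat_def
  show "p * q * s = p * (q * s)" "(p + q) * s = p * s + q * s" "p * (q + s) = p * q + p * s"
    "1 * p = p" "p * 1 = p" "(0::quat) \<noteq> 1"
    "a *\<^sub>R p * q = a *\<^sub>R (p * q)" "p * a *\<^sub>R q = a *\<^sub>R (p * q)"
    by (simp_all add: defs algebra_simps)
  show "inverse p * p = 1" "p * inverse p = 1" if "p \<noteq> 0"
  proof -
    have n0: "inner p p \<noteq> 0" using that by simp
    have e: "Quat (qr p) (- qi p) (- qj p) (- qk p) * p = inner p p *\<^sub>R 1"
      "p * Quat (qr p) (- qi p) (- qj p) (- qk p) = inner p p *\<^sub>R 1"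
      by (simp_all add: defs inner_quat_def)
    have sl: "(a *\<^sub>R u) * v = a *\<^sub>R (u * v)" "u * (a *\<^sub>R v) = a *\<^sub>R (u * v)" for a and u v :: quat
      by (simp_all add: defs algebra_simps)
    show "inverse p * p = 1" "p * inverse p = 1"
      using n0 unfolding inverse_quat_def by (simp_all add: sl e)
  qed
  show "p div q = p * inverse q" by (simp add: divide_quat_def)
  show "inverse (0::quat) = 0" by (simp add: defs inverse_quat_def)
  have "inner (p * q) (p * q) = inner p p * inner q q"
    by (simp add: inner_quat_def times_quat_def) algebra
  then show "norm (p * q) = norm p * norm q"
    by (simp add: norm_quat_def real_sqrt_mult)
qed

end

definition imag_units :: "quat set" where
  "imag_units = {q. q\<^sup>2 = - 1}"

text \<open>For an imaginary unit \<open>I\<close>, \<open>emb I\<close> identifies the type \<^typ>\<open>complex\<close> with the real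
  subalgebra of the quaternions spanned by \<open>1\<close> and \<open>I\<close>. Below, \<open>emb i\<close> is used for the
  fixed copy of the complex numbers inside the quaternions.\<close>

definition emb :: "quat \<Rightarrow> complex \<Rightarrow> quat" where
  "emb I z = of_real (Re z) + of_real (Im z) * I"

definition slice :: "quat set \<Rightarrow> quat \<Rightarrow> complex set" where
  "slice \<Omega> I = {z. emb I z \<in> \<Omega>}"

definition domain_set :: "'a::topological_space set \<Rightarrow> bool" where
  "domain_set U \<longleftrightarrow> open U \<and> connected U \<and> U \<noteq> {}"

definition symmetric_slice_domain :: "quat set \<Rightarrow> bool" where
  "symmetric_slice_domain \<Omega> \<longleftrightarrow>
     domain_set \<Omega> \<and> \<Omega> \<inter> \<real> \<noteq> {} \<and>
     (\<forall>I\<in>imag_units. domain_set (slice \<Omega> I)) \<and>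
     (\<forall>x y. \<forall>I\<in>imag_units. \<forall>I'\<in>imag_units.
        of_real x + of_real y * I \<in> \<Omega> \<longrightarrow> of_real x + of_real y * I' \<in> \<Omega>)"

text \<open>The functions in \<open>SR \<Omega>\<close> have domain \<open>\<Omega>\<close>, encoded by \<^const>\<open>extensional\<close>. For a real
  Frechet derivative \<open>D\<close> of \<open>x + \<i>y \<mapsto> f (x + yI)\<close>, the partial derivatives in \<open>x\<close> and \<open>y\<close>
  are \<open>D 1\<close> and \<open>D \<i>\<close>.\<close>

definition slice_regular :: "quat set \<Rightarrow> (quat \<Rightarrow> quat) \<Rightarrow> bool" where
  "slice_regular \<Omega> f \<longleftrightarrow>
     (\<forall>I\<in>imag_units. \<forall>z\<in>slice \<Omega> I. \<exists>D.
        ((\<lambda>w. f (emb I w)) has_derivative D) (at z) \<and>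
        (1/2) *\<^sub>R (D 1 + I * D \<i>) = 0)"

definition SR :: "quat set \<Rightarrow> (quat \<Rightarrow> quat) set" where
  "SR \<Omega> = {f \<in> extensional \<Omega>. slice_regular \<Omega> f}"

text \<open>The complex coordinates \<open>(u, v)\<close> of \<open>q = u + v j\<close>.\<close>

definition split_coords :: "quat \<Rightarrow> quat \<Rightarrow> quat \<Rightarrow> complex \<times> complex" where
  "split_coords i j q = (THE p. q = emb i (fst p) + emb i (snd p) * j)"

definition split_g :: "quat \<Rightarrow> quat \<Rightarrow> (quat \<Rightarrow> quat) \<Rightarrow> complex \<Rightarrow> complex" where
  "split_g i j f z = fst (split_coords i j (f (emb i z)))"

definition split_h :: "quat \<Rightarrow> quat \<Rightarrow> (quat \<Rightarrow> quat) \<Rightarrow> complex \<Rightarrow> complex" where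
  "split_h i j f z = snd (split_coords i j (f (emb i z)))"

definition hat :: "(complex \<Rightarrow> complex) \<Rightarrow> complex \<Rightarrow> complex" where
  "hat g z = cnj (g (cnj z))"

definition Phi :: "quat \<Rightarrow> quat \<Rightarrow> (quat \<Rightarrow> quat) \<Rightarrow> complex \<Rightarrow> complex^2^2" where
  "Phi i j f z = vector [vector [split_g i j f z, - hat (split_h i j f) z],
                         vector [split_h i j f z, hat (split_g i j f) z]]"

definition quat_blocks :: "(complex^2^2) set" where
  "quat_blocks = {M. \<exists>z w. M = vector [vector [z, - cnj w], vector [w, cnj z]]}"

definition block_A :: "complex^4^4 \<Rightarrow> complex^2^2" where
  "block_A T = vector [vector [T$1$1, T$1$2], vector [T$2$1, T$2$2]]"

definition block_B :: "complex^4^4 \<Rightarrow> complex^2^2" where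
  "block_B T = vector [vector [T$1$3, T$1$4], vector [T$2$3, T$2$4]]"

definition block_C :: "complex^4^4 \<Rightarrow> complex^2^2" where
  "block_C T = vector [vector [T$3$1, T$3$2], vector [T$4$1, T$4$2]]"

definition block_D :: "complex^4^4 \<Rightarrow> complex^2^2" where
  "block_D T = vector [vector [T$3$3, T$3$4], vector [T$4$3, T$4$4]]"

definition B_H :: "(complex^4^4) monoid" where
  "B_H = \<lparr>carrier = {T. invertible T \<and> block_B T = 0 \<and> block_A T \<in> quat_blocks \<and>
                        block_C T \<in> quat_blocks \<and> block_D T \<in> quat_blocks},
          monoid.mult = (**), one = mat 1\<rparr>"

definition real_scalars :: "(complex^4^4) set" where
  "real_scalars = {mat (complex_of_real r) | r. r \<noteq> 0}"

definition Gamma_univ :: "(complex^4^4) set monoid" where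
  "Gamma_univ = B_H Mod real_scalars"

text \<open>An element \<open>X\<close> of the quotient is a coset, namely the set of its representatives \<open>T\<close>;
  all of them give the same matrix function.\<close>

definition gact :: "quat \<Rightarrow> quat \<Rightarrow> quat set \<Rightarrow> (complex^4^4) set \<Rightarrow> (quat \<Rightarrow> quat) \<Rightarrow> (quat \<Rightarrow> quat)"
  where
  "gact i j \<Omega> X f = (THE F. F \<in> SR \<Omega> \<and>
     (\<forall>T\<in>X. \<forall>z\<in>slice \<Omega> i.
        Phi i j F z = (block_C T + block_D T ** Phi i j f z) ** matrix_inv (block_A T)))"

text \<open>Only the values \<open>b m\<close> with \<open>1 \<le> m < n\<close> matter.\<close>

definition npoly :: "quat set \<Rightarrow> nat \<Rightarrow> (nat \<Rightarrow> quat) \<Rightarrow> (quat \<Rightarrow> quat)" where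
  "npoly \<Omega> n b = restrict (\<lambda>q. q ^ n + (\<Sum>m = 1..<n. q ^ m * b m)) \<Omega>"

definition Npolys :: "quat set \<Rightarrow> nat \<Rightarrow> (quat \<Rightarrow> quat) set" where
  "Npolys \<Omega> n = {npoly \<Omega> n b | b. True}"

definition stab_N :: "quat \<Rightarrow> quat \<Rightarrow> quat set \<Rightarrow> nat \<Rightarrow> (complex^4^4) set set" where
  "stab_N i j \<Omega> n = {X \<in> carrier Gamma_univ. gact i j \<Omega> X ` Npolys \<Omega> n = Npolys \<Omega> n}"

definition H_units :: "quat monoid" where
  "H_units = \<lparr>carrier = UNIV - {0}, monoid.mult = (*), one = 1\<rparr>"

definition R_units :: "quat set" where
  "R_units = \<real> - {0}"

definition PH :: "quat set monoid" where
  "PH = H_units Mod R_units"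

definition SO3 :: "(real^3^3) monoid" where
  "SO3 = \<lparr>carrier = {Q. rotation_matrix Q}, monoid.mult = (**), one = mat 1\<rparr>"

end

theory Submission
  imports Defs "HOL-Complex_Analysis.Conformal_Mappings"
begin

text \<open>
  Write a quaternion as \<open>q = u + v j\<close> with \<open>u, v\<close> in the copy of the complex numbers spanned by
  \<open>1\<close> and \<open>i\<close>, and let \<open>Q(q)\<close> be the complex matrix with rows \<open>(u, - cnj v)\<close> and \<open>(v, cnj u)\<close>.
  The map \<open>Q\<close> is additive and injective, it reverses products, and its image is the set of blocks
  allowed in the group. The function \<open>q^m b\<close> has the matrix \<open>z^m Q(b)\<close>. Hence the transformation
  \<open>(C + D \<Phi>) A\<^sup>-\<^sup>1\<close> with \<open>A = Q(a)\<close>, \<open>C = Q(c)\<close>, \<open>D = Q(d)\<close> sends a polynomial with coefficients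
  \<open>b\<^sub>m\<close> to the polynomial with coefficients \<open>a\<^sup>-\<^sup>1 b\<^sub>m d\<close>, except that \<open>a\<^sup>-\<^sup>1 c\<close> is added in degree \<open>0\<close>
  (lemma \<open>gact_qpoly\<close>).

  The coefficients of a polynomial can be read off from its values on \<open>\<Omega>\<close>, because \<open>\<Omega>\<close> contains a
  real interval. So a monic polynomial without constant term is sent to one of the same kind exactly
  when \<open>c = 0\<close> and \<open>d = a\<close>, and then the coefficients are conjugated by \<open>\<eta> = a\<^sup>-\<^sup>1\<close> (lemma
  \<open>gact_npoly_eq_npoly_iff\<close>). This describes the orbits. It also shows that the classes that preserve
  the set of these polynomials are those of the block diagonal matrices with both blocks equal to
  \<open>Q(\<eta>\<^sup>-\<^sup>1)\<close>. As inversion and \<open>Q\<close> both reverse products, \<open>\<eta>\<close> is mapped homomorphically to this class, and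
  the class is trivial exactly for real \<open>\<eta>\<close>.

  The transformed function is characterised by its matrix function, so one must know that the matrix
  function determines a slice regular function. The matrices determine the values at the real
  points of \<open>\<Omega>\<close>. On each slice, suitable complex-valued projections of a slice regular function are
  holomorphic, so the identity theorem for holomorphic functions carries equality from the real
  points to the whole slice, and the slices cover \<open>\<Omega>\<close> (lemma \<open>SR_eqI_real\<close>).

  Finally, conjugation by \<open>\<eta>\<close> acts on the imaginary quaternions as a rotation, which is trivial exactly
  for real \<open>\<eta>\<close>, and every rotation arises in this way (lemma \<open>rotation_matrix_is_conj_matrix\<close>).
\<close>

section \<open>Quaternions and rotations of space\<close>

lemmas quat_components = quat_eq_iff plus_quat_def minus_quat_def uminus_quat_def
  zero_quat_def one_quat_def times_quat_def scaleR_quat_def inner_quat_def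

lemma of_real_quat: "of_real x = Quat x 0 0 0"
  by (simp add: of_real_def quat_components)

lemma of_real_quat_commute: "of_real x * q = q * (of_real x :: quat)"
  by (simp add: of_real_quat quat_components)

lemma qr_mult_commute: "qr (p * q) = qr (q * p)"
  by (simp add: times_quat_def algebra_simps)

lemma real_if_central:
  fixes \<eta> :: quat
  assumes "\<And>q. \<eta> * q = q * \<eta>"
  shows "\<eta> \<in> \<real>"
proof -
  have "qi \<eta> = 0" "qj \<eta> = 0" "qk \<eta> = 0"
    using assms[of "Quat 0 1 0 0"] assms[of "Quat 0 0 1 0"] by (simp_all add: quat_components)
  then have "\<eta> = of_real (qr \<eta>)"
    by (simp add: of_real_quat quat_eq_iff)
  then show ?thesis
    by (metis Reals_of_real)
qed

definition quat_of_vec :: "real^3 \<Rightarrow> quat" where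
  "quat_of_vec v = Quat 0 (v$1) (v$2) (v$3)"

definition vec_of_quat :: "quat \<Rightarrow> real^3" where
  "vec_of_quat q = vector [qi q, qj q, qk q]"

lemma vec_of_quat_of_vec [simp]: "vec_of_quat (quat_of_vec v) = v"
  by (simp add: vec_of_quat_def quat_of_vec_def vec_eq_iff forall_3)

lemma quat_of_vec_of_quat: "qr q = 0 \<Longrightarrow> quat_of_vec (vec_of_quat q) = q"
  by (simp add: vec_of_quat_def quat_of_vec_def quat_eq_iff)

lemma linear_vec_of_quat: "linear vec_of_quat"
  by (rule linearI) (simp_all add: vec_of_quat_def quat_components vec_eq_iff forall_3)

lemma linear_quat_of_vec: "linear quat_of_vec"
  by (rule linearI) (simp_all add: quat_of_vec_def quat_components)

lemma qr_quat_of_vec [simp]: "qr (quat_of_vec v) = 0"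
  by (simp add: quat_of_vec_def)

lemma norm_quat_of_vec: "norm (quat_of_vec v) = norm v"
  by (simp add: norm_eq_sqrt_inner quat_of_vec_def inner_quat_def inner_vec_def sum_3)

text \<open>The product of imaginary quaternions encodes both the scalar and the vector product. A map that
  respects this product and the scalar product therefore respects the vector product, which is how
  orientation enters below.\<close>
lemma quat_of_vec_mult:
  "quat_of_vec v * quat_of_vec w = quat_of_vec (cross3 v w) - of_real (v \<bullet> w)"
  by (simp add: quat_of_vec_def of_real_quat quat_components cross3_def inner_vec_def sum_3)

definition conj_matrix :: "quat \<Rightarrow> real^3^3" where
  "conj_matrix \<eta> = matrix (\<lambda>v. vec_of_quat (\<eta> * quat_of_vec v * inverse \<eta>))"

lemma conj_matrix_mult_vec:
  "conj_matrix \<eta> *v v = vec_of_quat (\<eta> * quat_of_vec v * inverse \<eta>)"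
proof -
  have "linear ((\<lambda>q. \<eta> * q * inverse \<eta>) \<circ> quat_of_vec)"
    by (intro linear_compose linear_quat_of_vec) (simp add: linear_iff algebra_simps)
  from linear_compose[OF this linear_vec_of_quat]
  show ?thesis
    unfolding conj_matrix_def by (simp add: o_def matrix_vector_mul(2))
qed

lemma quat_of_vec_conj_matrix:
  assumes "\<eta> \<noteq> 0"
  shows "quat_of_vec (conj_matrix \<eta> *v v) = \<eta> * quat_of_vec v * inverse \<eta>"
proof -
  have "qr (\<eta> * quat_of_vec v * inverse \<eta>) = qr (inverse \<eta> * (\<eta> * quat_of_vec v))"
    by (rule qr_mult_commute)
  also have "\<dots> = 0"
    using assms by (simp flip: mult.assoc)
  finally show ?thesis
    by (simp add: conj_matrix_mult_vec quat_of_vec_of_quat)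
qed

lemma conj_matrix_mult:
  assumes "\<eta> \<noteq> 0" "\<xi> \<noteq> 0"
  shows "conj_matrix (\<eta> * \<xi>) = conj_matrix \<eta> ** conj_matrix \<xi>"
proof -
  have "conj_matrix (\<eta> * \<xi>) *v v = (conj_matrix \<eta> ** conj_matrix \<xi>) *v v" for v
  proof -
    have "(conj_matrix \<eta> ** conj_matrix \<xi>) *v v = conj_matrix \<eta> *v (conj_matrix \<xi> *v v)"
      by (simp add: matrix_vector_mul_assoc)
    also have "\<dots> = vec_of_quat (\<eta> * (\<xi> * quat_of_vec v * inverse \<xi>) * inverse \<eta>)"
      unfolding conj_matrix_mult_vec[of \<eta>] quat_of_vec_conj_matrix[OF assms(2)] ..
    also have "\<dots> = conj_matrix (\<eta> * \<xi>) *v v"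
      using assms by (simp add: conj_matrix_mult_vec nonzero_inverse_mult_distrib mult.assoc)
    finally show ?thesis ..
  qed
  then show ?thesis
    by (simp add: matrix_eq)
qed

text \<open>Conjugation preserves the norm, hence the matrix is orthogonal. It preserves the product too, hence
  the vector product, and an orthogonal matrix multiplies vector products by its determinant.\<close>
lemma rotation_matrix_conj_matrix:
  assumes "\<eta> \<noteq> 0"
  shows "rotation_matrix (conj_matrix \<eta>)"
proof -
  define R where "R = conj_matrix \<eta>"
  have R: "quat_of_vec (R *v v) = \<eta> * quat_of_vec v * inverse \<eta>" for v
    unfolding R_def using assms by (rule quat_of_vec_conj_matrix)
  have "norm (R *v v) = norm v" for v
  proof -
    have "norm (R *v v) = norm (\<eta> * quat_of_vec v * inverse \<eta>)"
      by (metis R norm_quat_of_vec)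
    also have "\<dots> = norm v"
      using assms by (simp add: norm_mult norm_inverse norm_quat_of_vec)
    finally show ?thesis .
  qed
  then have orth: "orthogonal_transformation ((*v) R)"
    by (simp add: orthogonal_transformation)
  then have ortho: "orthogonal_matrix R"
    by (simp add: orthogonal_transformation_matrix)
  have dot: "(R *v v) \<bullet> (R *v w) = v \<bullet> w" for v w
    using orth by (simp add: orthogonal_transformation_def)
  have cross: "cross3 (R *v v) (R *v w) = R *v cross3 v w" for v w
  proof -
    have "quat_of_vec (R *v v) * quat_of_vec (R *v w) =
        \<eta> * (quat_of_vec v * quat_of_vec w) * inverse \<eta>"
      using assms by (simp add: R mult.assoc flip: mult.assoc[of "inverse \<eta>" \<eta>])
    also have "\<dots> = quat_of_vec (R *v cross3 v w) - of_real (v \<bullet> w)"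
      using assms
      by (simp add: quat_of_vec_mult R right_diff_distrib left_diff_distrib
          flip: of_real_quat_commute[of _ \<eta>]) (simp add: mult.assoc)
    finally have "quat_of_vec (cross3 (R *v v) (R *v w)) = quat_of_vec (R *v cross3 v w)"
      by (simp add: quat_of_vec_mult dot)
    then show ?thesis
      by (metis vec_of_quat_of_vec)
  qed
  define e :: "real^3" where "e = R *v axis 3 1"
  have "e \<noteq> 0"
    using dot[of "axis 3 1" "axis 3 1"] by (auto simp: e_def inner_axis)
  moreover have "e = det R *\<^sub>R e"
    using cross_orthogonal_matrix[OF ortho, of "axis 1 1" "axis 2 1"]
    by (simp add: cross cross_basis e_def)
  ultimately have "det R = 1"
    by (metis scaleR_cancel_right scaleR_one)
  with ortho show ?thesis
    by (simp add: rotation_matrix_def R_def)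
qed

text \<open>Let \<open>e\<^sub>k\<close> be the standard imaginary units and \<open>u\<^sub>k\<close> their images under the rotation. The task is to find
  \<open>\<eta> \<noteq> 0\<close> with \<open>u\<^sub>k \<eta> = \<eta> e\<^sub>k\<close>. Averaging any quaternion \<open>p\<close> over the pairs \<open>(u\<^sub>k, e\<^sub>k)\<close>, that is, taking
  \<open>h(p) = p - \<Sum>\<^sub>k u\<^sub>k p e\<^sub>k\<close>, gives a solution of these equations, because the \<open>u\<^sub>k\<close> have the
  multiplication table of the \<open>e\<^sub>k\<close>. The linear map \<open>h\<close> is not zero: its trace is \<open>4\<close>, as \<open>p \<mapsto> u p e\<close> has
  trace \<open>0\<close> for imaginary \<open>u\<close> and \<open>e\<close>.\<close>
lemma rotation_matrix_is_conj_matrix: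
  assumes "rotation_matrix Q"
  obtains \<eta> where "\<eta> \<noteq> 0" "conj_matrix \<eta> = Q"
proof -
  define e where "e k = quat_of_vec (axis k 1)" for k :: 3
  define u where "u k = quat_of_vec (Q *v axis k 1)" for k :: 3
  define h where "h p = p - (\<Sum>k\<in>UNIV. u k * p * e k)" for p
  have e_mult: "e 1 * e 1 = -1" "e 2 * e 2 = -1" "e 3 * e 3 = -1"
      "e 1 * e 2 = e 3" "e 2 * e 3 = e 1" "e 3 * e 1 = e 2"
      "e 2 * e 1 = - e 3" "e 3 * e 2 = - e 1" "e 1 * e 3 = - e 2"
    by (simp_all add: e_def quat_of_vec_def quat_components axis_def)
  have u_mult: "u 1 * u 1 = -1" "u 2 * u 2 = -1" "u 3 * u 3 = -1"
      "u 1 * u 2 = u 3" "u 2 * u 3 = u 1" "u 3 * u 1 = u 2"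
      "u 2 * u 1 = - u 3" "u 3 * u 2 = - u 1" "u 1 * u 3 = - u 2"
  proof -
    have dot: "(Q *v v) \<bullet> (Q *v w) = v \<bullet> w" for v w
    proof -
      have "orthogonal_transformation ((*v) Q)"
        using assms by (simp add: orthogonal_transformation_matrix rotation_matrix_def)
      then show ?thesis by (simp add: orthogonal_transformation_def)
    qed
    show "u 1 * u 1 = -1" "u 2 * u 2 = -1" "u 3 * u 3 = -1"
      "u 1 * u 2 = u 3" "u 2 * u 3 = u 1" "u 3 * u 1 = u 2"
      "u 2 * u 1 = - u 3" "u 3 * u 2 = - u 1" "u 1 * u 3 = - u 2"
      by (simp_all add: u_def quat_of_vec_mult dot cross_rotation_matrix[OF assms] cross_basis
          inner_axis_axis linear_neg[OF linear_quat_of_vec] linear_0[OF linear_quat_of_vec]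
          linear_neg[OF matrix_vector_mul_linear])
  qed
  have intertwine: "u k * h p = h p * e k" for k p
  proof -
    have ue: "u a * (u b * x) = (u a * u b) * x" "x * e a * e b = x * (e a * e b)" for a b x
      by (simp_all add: mult.assoc)
    have "\<forall>k. u k * h p = h p * e k"
      unfolding forall_3 h_def sum_3
      by (simp add: algebra_simps ue u_mult e_mult)
    then show ?thesis by blast
  qed
  have "\<exists>p. h p \<noteq> 0"
  proof (rule ccontr)
    assume "\<not> ?thesis"
    then have "h 1 = 0" "h (e 1) = 0" "h (e 2) = 0" "h (e 3) = 0" by auto
    \<comment> \<open>The diagonal entries of \<open>h\<close> in the basis \<open>1, e\<^sub>1, e\<^sub>2, e\<^sub>3\<close> would all vanish, but their sum is \<open>4\<close>.\<close>
    then show False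
      by (simp add: h_def sum_3 u_def e_def quat_of_vec_def quat_components axis_def)
  qed
  then obtain p where p: "h p \<noteq> 0" ..
  have "conj_matrix (h p) *v axis k 1 = Q *v axis k 1" for k
  proof -
    have "h p * e k * inverse (h p) = u k"
      using p by (simp flip: intertwine add: mult.assoc)
    then show ?thesis
      by (simp add: conj_matrix_mult_vec e_def u_def)
  qed
  then have "conj_matrix (h p) = Q"
    by (simp add: vec_eq_iff matrix_vector_mul_component inner_axis)
  with p that show ?thesis by blast
qed

lemma conj_matrix_eq_1_iff:
  assumes "\<eta> \<noteq> 0"
  shows "conj_matrix \<eta> = mat 1 \<longleftrightarrow> \<eta> \<in> \<real>"
proof
  assume 1: "conj_matrix \<eta> = mat 1"
  have "\<eta> * q = q * \<eta>" for q
  proof -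
    have "quat_of_vec v = \<eta> * quat_of_vec v * inverse \<eta>" for v
      using quat_of_vec_conj_matrix[OF assms, of v] 1 by simp
    then have comm: "\<eta> * quat_of_vec v = quat_of_vec v * \<eta>" for v
      using assms by (metis mult.assoc left_inverse mult.right_neutral)
    have "q = of_real (qr q) + quat_of_vec (vec_of_quat q)"
      by (simp add: of_real_quat quat_of_vec_def vec_of_quat_def quat_components)
    then show ?thesis
      by (metis comm distrib_left distrib_right of_real_quat_commute)
  qed
  then show "\<eta> \<in> \<real>" by (rule real_if_central)
next
  assume "\<eta> \<in> \<real>"
  then obtain r where r: "\<eta> = of_real r" by (auto elim: Reals_cases)
  have "conj_matrix \<eta> *v v = v" for v
    using assms by (simp add: conj_matrix_mult_vec r of_real_quat_commute mult.assoc)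
  then show "conj_matrix \<eta> = mat 1"
    by (simp add: matrix_eq)
qed

lemma group_H_units: "group H_units"
proof (rule groupI)
  fix x assume "x \<in> carrier H_units"
  then show "\<exists>y\<in>carrier H_units. y \<otimes>\<^bsub>H_units\<^esub> x = \<one>\<^bsub>H_units\<^esub>"
    by (intro bexI[of _ "inverse x"]) (auto simp: H_units_def)
qed (auto simp: H_units_def mult.assoc)

lemma group_SO3: "group SO3"
proof (rule groupI)
  fix Q assume "Q \<in> carrier SO3"
  then have Q: "orthogonal_matrix Q" "det Q = 1"
    by (auto simp: SO3_def rotation_matrix_def)
  then have "transpose Q \<in> carrier SO3" "transpose Q ** Q = mat 1"
    by (auto simp: SO3_def rotation_matrix_def orthogonal_matrix_def det_transpose)
  then show "\<exists>P\<in>carrier SO3. P \<otimes>\<^bsub>SO3\<^esub> Q = \<one>\<^bsub>SO3\<^esub>"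
    by (auto simp: SO3_def)
qed (auto simp: SO3_def rotation_matrix_def orthogonal_matrix_mul orthogonal_matrix_id det_mul
      matrix_mul_assoc)

lemma conj_matrix_group_hom: "group_hom H_units SO3 conj_matrix"
  by (intro group_hom.intro group_hom_axioms.intro group_H_units group_SO3)
    (auto simp: hom_def H_units_def SO3_def rotation_matrix_conj_matrix conj_matrix_mult)

lemma kernel_conj_matrix: "kernel H_units SO3 conj_matrix = R_units"
  by (auto simp: kernel_def H_units_def SO3_def R_units_def conj_matrix_eq_1_iff)

lemma PH_iso_SO3: "PH \<cong> SO3"
proof -
  have "Q \<in> conj_matrix ` (UNIV - {0})" if "rotation_matrix Q" for Q
    using rotation_matrix_is_conj_matrix[OF that] by blast
  then have "conj_matrix ` carrier H_units = carrier SO3"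
    by (auto simp: H_units_def SO3_def rotation_matrix_conj_matrix)
  from group_hom.FactGroup_iso[OF conj_matrix_group_hom this] show ?thesis
    by (simp add: PH_def kernel_conj_matrix)
qed

lemma R_units_normal: "R_units \<lhd> H_units"
  using group_hom.normal_kernel[OF conj_matrix_group_hom] by (simp add: kernel_conj_matrix)

section \<open>Slices and the identity principle\<close>

lemma imag_unit_mult_self: "I \<in> imag_units \<Longrightarrow> I * I = - 1"
  by (simp add: imag_units_def power2_eq_square)

lemma imag_unit_minus: "I \<in> imag_units \<Longrightarrow> - I \<in> imag_units"
  by (simp add: imag_units_def)

lemma imag_unit_components:
  assumes "I \<in> imag_units"
  shows "qr I = 0" "(qi I)\<^sup>2 + (qj I)\<^sup>2 + (qk I)\<^sup>2 = 1"
proof -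
  have sq: "qr I * qr I - qi I * qi I - qj I * qj I - qk I * qk I = -1"
    "qr I * qi I = 0" "qr I * qj I = 0" "qr I * qk I = 0"
    using imag_unit_mult_self[OF assms] by (simp_all add: quat_components algebra_simps)
  show "qr I = 0"
  proof (rule ccontr)
    assume "qr I \<noteq> 0"
    then have "qr I * qr I = -1" using sq by simp
    then show False by (metis not_one_le_zero zero_le_square neg_0_le_iff_le)
  qed
  then show "(qi I)\<^sup>2 + (qj I)\<^sup>2 + (qk I)\<^sup>2 = 1"
    using sq(1) by (simp add: power2_eq_square)
qed

lemma linear_emb: "linear (emb I)"
  by (rule linearI) (simp_all add: emb_def of_real_def algebra_simps)

lemmas emb_add = linear_add[OF linear_emb] and emb_diff = linear_diff[OF linear_emb]
  and emb_0 [simp] = linear_0[OF linear_emb] and emb_minus = linear_neg[OF linear_emb]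

lemma emb_of_real [simp]: "emb I (of_real x) = of_real x"
  by (simp add: emb_def)

lemma emb_1 [simp]: "emb I 1 = 1"
  by (simp add: emb_def)

lemma emb_ii [simp]: "emb I \<i> = I"
  by (simp add: emb_def)

lemma emb_mult:
  assumes "I \<in> imag_units"
  shows "emb I (z * w) = emb I z * emb I w"
proof -
  have "emb I z * emb I w = of_real (Re z * Re w) + of_real (Im z * Im w) * (I * I)
      + of_real (Re z * Im w + Im z * Re w) * I"
    by (simp add: emb_def of_real_def algebra_simps)
  then show ?thesis
    by (simp add: imag_unit_mult_self[OF assms] emb_def)
qed

lemma emb_power: "I \<in> imag_units \<Longrightarrow> emb I (z ^ m) = emb I z ^ m"
  by (induction m) (simp_all add: emb_mult)

lemma emb_eq_0_iff:
  assumes "I \<in> imag_units"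
  shows "emb I z = 0 \<longleftrightarrow> z = 0"
proof
  assume "emb I z = 0"
  then have "emb I (inverse z * z) = 0"
    by (simp add: emb_mult[OF assms])
  then show "z = 0"
    by (metis emb_1 left_inverse zero_neq_one)
qed simp

text \<open>Commuting with \<open>I\<close> means that the vector part has zero vector product with \<open>I\<close>, so it is a multiple of
  \<open>I\<close>; since \<open>I\<close> has length \<open>1\<close>, the factor is the scalar product with \<open>I\<close>.\<close>
lemma commutes_imag_unit_imp_emb:
  assumes "I \<in> imag_units" and comm: "q * I = I * q"
  shows "q = emb I (Complex (qr q) (qi q * qi I + qj q * qj I + qk q * qk I))"
proof -
  note I = imag_unit_components[OF assms(1)]
  have cross: "qj q * qk I = qk q * qj I" "qk q * qi I = qi q * qk I" "qi q * qj I = qj q * qi I"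
    using comm by (auto simp add: quat_components I mult.commute)
  have "qi q = (qi q * qi I + qj q * qj I + qk q * qk I) * qi I"
    using I(2) cross by algebra
  moreover have "qj q = (qi q * qi I + qj q * qj I + qk q * qk I) * qj I"
    using I(2) cross by algebra
  moreover have "qk q = (qi q * qi I + qj q * qj I + qk q * qk I) * qk I"
    using I(2) cross by algebra
  ultimately show ?thesis
    by (simp add: emb_def of_real_quat quat_components I(1))
qed

lemma quat_in_some_slice:
  obtains I z where "I \<in> imag_units" "q = emb I z"
proof (cases "q \<in> \<real>")
  case True
  then obtain x where "q = of_real x" by (rule Reals_cases)
  moreover have "Quat 0 1 0 0 \<in> imag_units"
    by (simp add: imag_units_def power2_eq_square quat_components)
  ultimately show ?thesis
    by (metis that emb_of_real)
next
  case False
  define s where "s = sqrt ((qi q)\<^sup>2 + (qj q)\<^sup>2 + (qk q)\<^sup>2)"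
  have s: "s * s = (qi q)\<^sup>2 + (qj q)\<^sup>2 + (qk q)\<^sup>2"
    by (simp add: s_def)
  have "s \<noteq> 0"
  proof
    assume "s = 0"
    with s have "q = of_real (qr q)"
      by (simp add: of_real_quat quat_eq_iff add_nonneg_eq_0_iff)
    with False show False by (metis Reals_of_real)
  qed
  define I where "I = Quat 0 (qi q / s) (qj q / s) (qk q / s)"
  have "I * I = - 1"
    using \<open>s \<noteq> 0\<close> s[symmetric]
    by (simp add: I_def quat_components divide_simps power2_eq_square)
  then have "I \<in> imag_units"
    by (simp add: imag_units_def power2_eq_square)
  moreover have "q = emb I (Complex (qr q) s)"
    using \<open>s \<noteq> 0\<close> by (simp add: emb_def I_def of_real_quat quat_components)
  ultimately show ?thesis by (rule that)
qed

lemma symmetric_slice_domain_cnj: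
  assumes "symmetric_slice_domain \<Omega>" "I \<in> imag_units" "z \<in> slice \<Omega> I"
  shows "cnj z \<in> slice \<Omega> I"
proof -
  have "of_real (Re z) + of_real (Im z) * I \<in> \<Omega>"
    using assms(3) by (simp add: slice_def emb_def)
  then have "of_real (Re z) + of_real (Im z) * (- I) \<in> \<Omega>"
    using assms(1,2) imag_unit_minus[OF assms(2)] unfolding symmetric_slice_domain_def by blast
  then show ?thesis
    by (simp add: slice_def emb_def)
qed

lemma real_points_islimpt:
  assumes "symmetric_slice_domain \<Omega>"
  obtains x where "of_real x \<in> \<Omega>" "x islimpt {x. of_real x \<in> \<Omega>}"
proof -
  have "open {x::real. (of_real x :: quat) \<in> \<Omega>}"
    using assms continuous_open_preimage[of UNIV "of_real :: real \<Rightarrow> quat" \<Omega>]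
    by (simp add: symmetric_slice_domain_def domain_set_def vimage_def continuous_on_of_real)
  moreover obtain x where "of_real x \<in> \<Omega>"
    using assms by (auto simp: symmetric_slice_domain_def elim!: Reals_cases)
  ultimately show ?thesis
    using that by (metis interior_limit_point interior_open mem_Collect_eq)
qed

text \<open>The identity principle: on each slice a slice regular function satisfies the Cauchy-Riemann
  equation for left multiplication by \<open>I\<close>, so any real-linear map \<open>p\<close> to the complex numbers with
  \<open>p(I w) = \<i> p(w)\<close> turns it into a holomorphic function. To see that the difference of two functions
  vanishes at one point it is enough to use a single such \<open>p\<close>, adapted to the value \<open>v\<close> of the difference
  there.\<close>
lemma SR_eqI_real:
  assumes \<Omega>: "symmetric_slice_domain \<Omega>" and "F \<in> SR \<Omega>" "G \<in> SR \<Omega>"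
    and eq: "\<And>x. of_real x \<in> \<Omega> \<Longrightarrow> F (of_real x) = G (of_real x)"
  shows "F = G"
proof
  fix q
  show "F q = G q"
  proof (cases "q \<in> \<Omega>")
    case False
    then show ?thesis
      using assms by (simp add: SR_def extensional_def)
  next
    case True
    obtain I z where I: "I \<in> imag_units" and q: "q = emb I z"
      by (rule quat_in_some_slice)
    have z: "z \<in> slice \<Omega> I"
      using True by (simp add: slice_def q)
    define v where "v = F q - G q"
    \<comment> \<open>This map is complex linear for left multiplication by \<open>I\<close>, and the real part of \<open>p v\<close> is \<open>v \<bullet> v\<close>.\<close>
    define p where "p w = Complex (w \<bullet> v) (- ((I * w) \<bullet> v))" for w
    have lin: "bounded_linear p"
    proof (rule bounded_linear_intro)
      show "norm (p w) \<le> norm w * (norm v + norm I * norm v)" for w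
      proof -
        have "norm (p w) \<le> \<bar>w \<bullet> v\<bar> + \<bar>(I * w) \<bullet> v\<bar>"
          using cmod_le[of "p w"] by (simp add: p_def)
        also have "\<dots> \<le> norm w * norm v + norm (I * w) * norm v"
          by (intro add_mono Cauchy_Schwarz_ineq2)
        finally show ?thesis
          by (simp add: norm_mult algebra_simps)
      qed
    qed (simp_all add: p_def inner_add_left distrib_left complex_eq_iff)
    have p_I: "p (I * w) = \<i> * p w" for w
      by (simp add: p_def complex_eq_iff imag_unit_mult_self[OF I] flip: mult.assoc)
    have hol: "(\<lambda>w. p (F (emb I w) - G (emb I w))) holomorphic_on slice \<Omega> I"
      unfolding holomorphic_on_def
    proof
      fix w assume w: "w \<in> slice \<Omega> I"
      obtain D where D: "((\<lambda>w. F (emb I w)) has_derivative D) (at w)" "D 1 + I * D \<i> = 0"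
        using assms(2) w I unfolding SR_def slice_regular_def by fastforce
      obtain D' where D': "((\<lambda>w. G (emb I w)) has_derivative D') (at w)" "D' 1 + I * D' \<i> = 0"
        using assms(3) w I unfolding SR_def slice_regular_def by fastforce
      define E where "E h = p (D h - D' h)" for h
      have E: "((\<lambda>w. p (F (emb I w) - G (emb I w))) has_derivative E) (at w)"
        unfolding E_def
        by (intro bounded_linear.has_derivative[OF lin] has_derivative_diff D(1) D'(1))
      then have linE: "linear E"
        using has_derivative_linear by blast
      have "I * (I * D \<i>) = - D \<i>" "I * (I * D' \<i>) = - D' \<i>"
        by (simp_all add: imag_unit_mult_self[OF I] flip: mult.assoc)
      then have "D \<i> = I * D 1" "D' \<i> = I * D' 1"
        using D(2) D'(2) by (simp_all add: eq_neg_iff_add_eq_0[symmetric])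
      then have "E \<i> = \<i> * E 1"
        by (simp add: E_def p_I flip: right_diff_distrib)
      have "E h = E 1 * h" for h
      proof -
        have "E h = E (Re h *\<^sub>R 1 + Im h *\<^sub>R \<i>)"
          by (rule arg_cong[of _ _ E]) (simp add: complex_eq_iff)
        also have "\<dots> = Re h *\<^sub>R E 1 + Im h *\<^sub>R E \<i>"
          by (simp only: linear_add[OF linE] linear_cmul[OF linE])
        also have "\<dots> = E 1 * h"
          by (simp add: \<open>E \<i> = \<i> * E 1\<close> complex_eq_iff algebra_simps)
        finally show ?thesis .
      qed
      then have "E = (*) (E 1)"
        by (rule ext)
      with E have "((\<lambda>w. p (F (emb I w) - G (emb I w))) has_field_derivative E 1) (at w)"
        unfolding has_field_derivative_def by simp
      then show "(\<lambda>w. p (F (emb I w) - G (emb I w))) field_differentiable at w within slice \<Omega> I"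
        using field_differentiable_at_within field_differentiable_def by blast
    qed
    have dom: "open (slice \<Omega> I)" "connected (slice \<Omega> I)"
      using \<Omega> I by (auto simp: symmetric_slice_domain_def domain_set_def)
    obtain x where x: "of_real x \<in> \<Omega>" "x islimpt {x. of_real x \<in> \<Omega>}"
      using \<Omega> by (rule real_points_islimpt)
    have lim: "complex_of_real x islimpt of_real ` {x. of_real x \<in> \<Omega>}"
      unfolding islimpt_approachable
    proof (intro allI impI)
      fix e :: real assume "e > 0"
      then obtain y where "of_real y \<in> \<Omega>" "y \<noteq> x" "dist y x < e"
        using x(2) unfolding islimpt_approachable by blast
      then show "\<exists>y\<in>of_real ` {x. of_real x \<in> \<Omega>}. y \<noteq> complex_of_real x \<and> dist y (of_real x) < e"
        by (intro bexI[of _ "of_real y"]) (auto simp: dist_of_real)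
    qed
    have "p (F (emb I z) - G (emb I z)) = 0"
      by (rule analytic_continuation[OF hol dom _ _ lim])
         (use x(1) z eq in \<open>auto simp: slice_def linear_0[OF bounded_linear.linear[OF lin]]\<close>)
    then have "v \<bullet> v = 0"
      by (simp add: p_def v_def q complex_eq_iff)
    then show ?thesis
      by (simp add: v_def)
  qed
qed

section \<open>Quaternionic polynomials\<close>

definition qpoly :: "quat set \<Rightarrow> nat \<Rightarrow> (nat \<Rightarrow> quat) \<Rightarrow> quat \<Rightarrow> quat" where
  "qpoly \<Omega> n b = restrict (\<lambda>q. \<Sum>m\<le>n. q ^ m * b m) \<Omega>"

lemma qpoly_in_SR:
  assumes \<Omega>: "symmetric_slice_domain \<Omega>"
  shows "qpoly \<Omega> n b \<in> SR \<Omega>"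
  unfolding SR_def slice_regular_def
proof (intro CollectI conjI ballI)
  fix I z assume I: "I \<in> imag_units" and z: "z \<in> slice \<Omega> I"
  define D where "D h = (\<Sum>m\<le>n. emb I (of_nat m * z ^ (m - 1) * h) * b m)" for h
  have lin: "bounded_linear (\<lambda>w. emb I w * c)" for c
    unfolding linear_conv_bounded_linear[symmetric]
    by (rule linearI) (simp_all add: emb_add linear_cmul[OF linear_emb] distrib_right)
  have "((\<lambda>w. \<Sum>m\<le>n. emb I (w ^ m) * b m) has_derivative D) (at z)"
    unfolding D_def
  proof (intro has_derivative_sum)
    fix m
    have "((\<lambda>w. w ^ m) has_derivative (\<lambda>h. of_nat m * z ^ (m - 1) * h)) (at z)"
      by (rule has_derivative_eq_rhs, (rule derivative_intros)+) (simp add: fun_eq_iff)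
    then show "((\<lambda>w. emb I (w ^ m) * b m) has_derivative
        (\<lambda>h. emb I (of_nat m * z ^ (m - 1) * h) * b m)) (at z)"
      by (rule bounded_linear.has_derivative[OF lin])
  qed
  then have "((\<lambda>w. qpoly \<Omega> n b (emb I w)) has_derivative D) (at z)"
  proof (rule has_derivative_transform_within_open)
    show "open (slice \<Omega> I)"
      using \<Omega> I by (auto simp: symmetric_slice_domain_def domain_set_def)
  qed (use z in \<open>auto simp: slice_def qpoly_def emb_power[OF I]\<close>)
  moreover have "D \<i> = I * D 1"
  proof -
    have "emb I (w * \<i>) = I * emb I w" for w
      using emb_mult[OF I, of \<i> w] by (simp add: mult.commute)
    then have "emb I (w * \<i>) * c = I * (emb I w * c)" for w c
      by (simp add: mult.assoc)
    then show ?thesis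
      by (simp add: D_def sum_distrib_left flip: mult.assoc[of _ _ \<i>])
  qed
  then have "D 1 + I * D \<i> = 0"
    by (simp add: imag_unit_mult_self[OF I] flip: mult.assoc)
  ultimately show "\<exists>D. ((\<lambda>w. qpoly \<Omega> n b (emb I w)) has_derivative D) (at z) \<and>
        (1/2) *\<^sub>R (D 1 + I * D \<i>) = 0"
    by auto
qed (simp add: qpoly_def)

text \<open>On the real axis, the scalar product of a polynomial with a fixed quaternion is an ordinary real
  polynomial. It vanishes only if all its coefficients do, as \<open>\<Omega>\<close> contains infinitely many reals.\<close>
lemma qpoly_eq_iff:
  assumes \<Omega>: "symmetric_slice_domain \<Omega>"
  shows "qpoly \<Omega> n b = qpoly \<Omega> n c \<longleftrightarrow> (\<forall>m\<le>n. b m = c m)"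
proof
  assume eq: "qpoly \<Omega> n b = qpoly \<Omega> n c"
  obtain x where "x islimpt {x. of_real x \<in> \<Omega>}"
    using \<Omega> by (rule real_points_islimpt)
  then have inf: "infinite {x::real. (of_real x :: quat) \<in> \<Omega>}"
    using islimpt_finite by blast
  have "(b m - c m) \<bullet> v = 0" if "m \<le> n" for m v
  proof -
    have "{x. of_real x \<in> \<Omega>} \<subseteq> {x. (\<Sum>m\<le>n. ((b m - c m) \<bullet> v) * x ^ m) = 0}"
    proof safe
      fix x :: real assume x: "of_real x \<in> \<Omega>"
      have "(\<Sum>m\<le>n. of_real x ^ m * b m) - (\<Sum>m\<le>n. of_real x ^ m * c m) = 0"
        using fun_cong[OF eq, of "of_real x"] x by (simp add: qpoly_def)
      then have "(\<Sum>m\<le>n. x ^ m *\<^sub>R (b m - c m)) = 0"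
        by (simp add: sum_subtractf scaleR_conv_of_real algebra_simps flip: of_real_power)
      then have "(\<Sum>m\<le>n. x ^ m *\<^sub>R (b m - c m)) \<bullet> v = 0"
        by simp
      then show "(\<Sum>m\<le>n. ((b m - c m) \<bullet> v) * x ^ m) = 0"
        by (simp add: inner_sum_left mult.commute)
    qed
    then have "infinite {x. (\<Sum>m\<le>n. ((b m - c m) \<bullet> v) * x ^ m) = 0}"
      using inf finite_subset by blast
    then show ?thesis
      using that polyfun_finite_roots[of "\<lambda>m. (b m - c m) \<bullet> v" n] by blast
  qed
  then show "\<forall>m\<le>n. b m = c m"
    by (metis eq_iff_diff_eq_0 inner_eq_zero_iff)
next
  assume "\<forall>m\<le>n. b m = c m"
  then show "qpoly \<Omega> n b = qpoly \<Omega> n c"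
    by (auto simp: qpoly_def intro!: restrict_ext sum.cong)
qed

lemma npoly_eq_qpoly:
  assumes "n \<ge> 1"
  shows "npoly \<Omega> n b = qpoly \<Omega> n (\<lambda>m. if m = 0 then 0 else if m = n then 1 else b m)"
proof -
  have "{..n} = insert 0 (insert n {1..<n})"
    using assms by auto
  then show ?thesis
    using assms by (auto simp: npoly_def qpoly_def intro!: restrict_ext sum.cong)
qed

lemma npoly_eq_iff:
  assumes "symmetric_slice_domain \<Omega>" "n \<ge> 1"
  shows "npoly \<Omega> n b = npoly \<Omega> n c \<longleftrightarrow> (\<forall>m\<in>{1..<n}. b m = c m)"
  using assms by (auto simp: npoly_eq_qpoly qpoly_eq_iff)

lemma carrier_PH: "carrier PH = {R_units #>\<^bsub>H_units\<^esub> \<eta> | \<eta>. \<eta> \<noteq> 0}"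
  by (auto simp: PH_def carrier_FactGroup H_units_def)

text \<open>Simultaneous conjugation of the coefficients is an action of \<open>\<eta>\<close> modulo reals. If \<open>\<eta>\<close> and \<open>\<xi>\<close> act alike and
  there is an intermediate coefficient to test on, then \<open>\<xi>\<^sup>-\<^sup>1 \<eta>\<close> commutes with every quaternion, so it is
  real.\<close>
lemma PH_action:
  fixes \<phi> :: "quat set \<Rightarrow> (quat \<Rightarrow> quat) \<Rightarrow> quat \<Rightarrow> quat"
  assumes \<Omega>: "symmetric_slice_domain \<Omega>" and n: "n \<ge> 1"
    and ext: "\<And>X. X \<in> carrier PH \<Longrightarrow> \<phi> X \<in> extensional (Npolys \<Omega> n)"
    and \<phi>: "\<And>\<eta> b. \<eta> \<noteq> 0 \<Longrightarrow> \<phi> (R_units #>\<^bsub>H_units\<^esub> \<eta>) (npoly \<Omega> n b) =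
      npoly \<Omega> n (\<lambda>m. \<eta> * b m * inverse \<eta>)"
  shows "group_action PH (Npolys \<Omega> n) \<phi>"
    and "n \<ge> 2 \<Longrightarrow> faithful_action PH (Npolys \<Omega> n) \<phi>"
proof -
  have bij: "\<phi> X \<in> Bij (Npolys \<Omega> n)" if X_in: "X \<in> carrier PH" for X
  proof -
    obtain \<eta> where \<eta>: "\<eta> \<noteq> 0" and X: "X = R_units #>\<^bsub>H_units\<^esub> \<eta>"
      using X_in unfolding carrier_PH by blast
    have cancel: "\<eta> * (inverse \<eta> * q * \<eta>) * inverse \<eta> = q" "inverse \<eta> * (\<eta> * q * inverse \<eta>) * \<eta> = q" for q
      using \<eta> by (simp_all add: mult.assoc) (simp_all flip: mult.assoc)
    have inv: "\<phi> (R_units #>\<^bsub>H_units\<^esub> inverse \<eta>) (npoly \<Omega> n b) =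
        npoly \<Omega> n (\<lambda>m. inverse \<eta> * b m * \<eta>)" for b
      using \<phi>[of "inverse \<eta>"] \<eta> by simp
    have "bij_betw (\<phi> X) (Npolys \<Omega> n) (Npolys \<Omega> n)"
      by (rule bij_betwI[where g = "\<phi> (R_units #>\<^bsub>H_units\<^esub> inverse \<eta>)"])
        (auto simp: Npolys_def X \<phi>[OF \<eta>] inv cancel)
    with ext[OF X_in] show ?thesis
      by (simp add: Bij_def)
  qed
  have "\<phi> (X \<otimes>\<^bsub>PH\<^esub> Y) = \<phi> X \<otimes>\<^bsub>BijGroup (Npolys \<Omega> n)\<^esub> \<phi> Y"
    if X: "X \<in> carrier PH" and Y: "Y \<in> carrier PH" for X Y
  proof -
    obtain \<eta> \<xi> where \<eta>: "\<eta> \<noteq> 0" "X = R_units #>\<^bsub>H_units\<^esub> \<eta>" and \<xi>: "\<xi> \<noteq> 0" "Y = R_units #>\<^bsub>H_units\<^esub> \<xi>"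
      using X Y unfolding carrier_PH by blast
    have XY: "X \<otimes>\<^bsub>PH\<^esub> Y = R_units #>\<^bsub>H_units\<^esub> (\<eta> * \<xi>)"
      using normal.rcos_sum[OF R_units_normal, of \<eta> \<xi>] \<eta> \<xi>
      by (simp add: PH_def FactGroup_def H_units_def)
    have "\<phi> (X \<otimes>\<^bsub>PH\<^esub> Y) = compose (Npolys \<Omega> n) (\<phi> X) (\<phi> Y)"
    proof (rule extensionalityI)
      show "\<phi> (X \<otimes>\<^bsub>PH\<^esub> Y) \<in> extensional (Npolys \<Omega> n)"
        using \<eta>(1) \<xi>(1) unfolding XY by (intro ext) (auto simp: carrier_PH)
      fix P assume "P \<in> Npolys \<Omega> n"
      then show "\<phi> (X \<otimes>\<^bsub>PH\<^esub> Y) P = compose (Npolys \<Omega> n) (\<phi> X) (\<phi> Y) P"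
        using \<eta> \<xi> unfolding XY
        by (auto simp: Npolys_def compose_eq \<phi> nonzero_inverse_mult_distrib mult.assoc)
    qed simp
    then show ?thesis
      using X Y by (simp add: BijGroup_def bij)
  qed
  moreover have "group PH"
    unfolding PH_def using R_units_normal by (rule normal.factorgroup_is_group)
  ultimately show act: "group_action PH (Npolys \<Omega> n) \<phi>"
    using bij by (intro group_action.intro group_hom.intro group_hom_axioms.intro group_BijGroup homI)
      (auto simp: BijGroup_def)
  show "faithful_action PH (Npolys \<Omega> n) \<phi>" if "n \<ge> 2"
  proof (intro faithful_action.intro act faithful_action_axioms.intro inj_onI)
    fix X Y assume "X \<in> carrier PH" "Y \<in> carrier PH" and eq: "\<phi> X = \<phi> Y"
    then obtain \<eta> \<xi> where \<eta>: "\<eta> \<noteq> 0" "X = R_units #>\<^bsub>H_units\<^esub> \<eta>" and \<xi>: "\<xi> \<noteq> 0" "Y = R_units #>\<^bsub>H_units\<^esub> \<xi>"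
      unfolding carrier_PH by blast
    have "inverse \<xi> * \<eta> * q = q * (inverse \<xi> * \<eta>)" for q
    proof -
      have "npoly \<Omega> n (\<lambda>m. \<eta> * q * inverse \<eta>) = npoly \<Omega> n (\<lambda>m. \<xi> * q * inverse \<xi>)"
        using eq \<phi>[of \<eta> "\<lambda>m. q"] \<phi>[of \<xi> "\<lambda>m. q"] \<eta> \<xi> by simp
      then have "\<eta> * q * inverse \<eta> = \<xi> * q * inverse \<xi>"
        using \<Omega> n that by (auto simp: npoly_eq_iff dest: bspec[of _ _ 1])
      then have "inverse \<xi> * (\<eta> * q * inverse \<eta>) * \<eta> = inverse \<xi> * (\<xi> * q * inverse \<xi>) * \<eta>"
        by simp
      then show ?thesis
        using \<eta>(1) \<xi>(1) by (simp add: mult.assoc) (simp flip: mult.assoc)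
    qed
    then have "inverse \<xi> * \<eta> \<in> \<real>" by (rule real_if_central)
    then obtain r where "inverse \<xi> * \<eta> = of_real r" by (rule Reals_cases)
    then have "\<eta> = \<xi> * of_real r"
      using \<xi>(1) by (metis mult.assoc mult_1 right_inverse)
    then have r: "\<eta> = of_real r * \<xi>" "r \<noteq> 0"
      using \<eta>(1) by (auto simp: of_real_quat_commute)
    then have "\<eta> \<in> R_units #>\<^bsub>H_units\<^esub> \<xi>"
      by (auto simp: r_coset_def R_units_def H_units_def intro!: bexI[of _ "of_real r"])
    moreover have "\<xi> \<in> carrier H_units" using \<xi>(1) by (simp add: H_units_def)
    ultimately show "X = Y"
      unfolding \<eta>(2) \<xi>(2)
      by (metis group.repr_independence[OF group_H_units] R_units_normal normal_imp_subgroup)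
  qed
qed

section \<open>Quaternions as complex matrices\<close>

lemma mat_mult_commute: "mat c ** A = A ** mat (c::'a::comm_semiring_1)"
  by (simp add: vec_eq_iff matrix_matrix_mult_def mat_def if_distrib[of "\<lambda>x. x * _"]
      if_distrib[of "\<lambda>x. _ * x"] mult.commute cong: if_cong)

lemma matrix_add_rdistrib: "(B + C) ** A = B ** A + C ** (A :: 'a::semiring_1^'n^'m)"
  by (simp add: vec_eq_iff matrix_matrix_mult_def sum.distrib distrib_right)

lemma matrix_inv_eqI:
  assumes "A ** B = mat 1" "B ** A = mat 1"
  shows "matrix_inv A = B"
proof -
  have "\<exists>A'. A ** A' = mat 1 \<and> A' ** A = mat 1"
    using assms by blast
  then have "A ** matrix_inv A = mat 1 \<and> matrix_inv A ** A = mat 1"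
    unfolding matrix_inv_def by (rule someI_ex)
  then have "matrix_inv A = matrix_inv A ** (A ** B)"
    by (simp add: assms)
  also have "\<dots> = B"
    using \<open>A ** matrix_inv A = mat 1 \<and> matrix_inv A ** A = mat 1\<close> by (simp add: matrix_mul_assoc)
  finally show ?thesis .
qed

lemma vector_4:
  "(vector [x, y, z, w] :: ('a::zero)^4) $ 1 = x"
  "(vector [x, y, z, w] :: ('a::zero)^4) $ 2 = y"
  "(vector [x, y, z, w] :: ('a::zero)^4) $ 3 = z"
  "(vector [x, y, z, w] :: ('a::zero)^4) $ 4 = w"
  unfolding vector_def by simp_all

text \<open>The value of \<open>Phi\<close> for a constant function.\<close>
definition qmat :: "quat \<Rightarrow> quat \<Rightarrow> quat \<Rightarrow> complex^2^2" where
  "qmat i j q = vector [vector [fst (split_coords i j q), - cnj (snd (split_coords i j q))],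
                        vector [snd (split_coords i j q), cnj (fst (split_coords i j q))]]"

definition lower_blocks :: "complex^2^2 \<Rightarrow> complex^2^2 \<Rightarrow> complex^2^2 \<Rightarrow> complex^4^4" where
  "lower_blocks A C D = vector
    [vector [A$1$1, A$1$2, 0, 0], vector [A$2$1, A$2$2, 0, 0],
     vector [C$1$1, C$1$2, D$1$1, D$1$2], vector [C$2$1, C$2$2, D$2$1, D$2$2]]"

lemma blocks_lower_blocks [simp]:
  "block_A (lower_blocks A C D) = A" "block_B (lower_blocks A C D) = 0"
  "block_C (lower_blocks A C D) = C" "block_D (lower_blocks A C D) = D"
  by (simp_all add: block_A_def block_B_def block_C_def block_D_def lower_blocks_def vector_4
      vec_eq_iff forall_2)

lemma lower_blocks_of_blocks:
  "block_B T = 0 \<Longrightarrow> lower_blocks (block_A T) (block_C T) (block_D T) = T"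
  by (simp add: block_A_def block_B_def block_C_def block_D_def lower_blocks_def vector_4
      vec_eq_iff forall_2 forall_4)

lemma lower_blocks_mult:
  "lower_blocks A C D ** lower_blocks A' C' D' =
   lower_blocks (A ** A') (C ** A' + D ** C') (D ** D')"
  by (simp add: lower_blocks_def vector_4 vec_eq_iff forall_4 matrix_matrix_mult_def sum_4 sum_2)

lemma lower_blocks_mat: "lower_blocks (mat c) 0 (mat c) = mat c"
  by (simp add: lower_blocks_def vector_4 vec_eq_iff forall_4 mat_def)

locale quat_frame =
  fixes i j :: quat
  assumes i_unit: "i \<in> imag_units" and j_unit: "j \<in> imag_units" and anticommute: "i * j = - (j * i)"
begin

lemma j_emb: "j * emb i u = emb i (cnj u) * j"
proof -
  have "j * (of_real x * i) = - (of_real x * i * j)" for x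
    using anticommute by (metis add.inverse_inverse minus_mult_left mult.assoc of_real_quat_commute)
  then show ?thesis
    by (simp add: emb_def distrib_left left_diff_distrib of_real_quat_commute)
qed

text \<open>If \<open>v \<noteq> 0\<close>, then \<open>j\<close> would lie in the complex line of \<open>i\<close>, hence commute with \<open>i\<close>.\<close>
lemma frame_independent:
  assumes "emb i u + emb i v * j = 0"
  shows "u = 0" "v = 0"
proof -
  show "v = 0"
  proof (rule ccontr)
    assume "v \<noteq> 0"
    then have "j = emb i (inverse v) * (emb i v * j)"
      by (simp flip: mult.assoc emb_mult[OF i_unit])
    also have "emb i v * j = - emb i u"
      using assms by (simp add: eq_neg_iff_add_eq_0 add.commute)
    also have "emb i (inverse v) * (- emb i u) = emb i (- inverse v * u)"
      by (simp add: emb_mult[OF i_unit] emb_minus)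
    finally obtain w where w: "j = emb i w" ..
    have "i * emb i w = emb i w * i"
      by (simp add: emb_def distrib_left distrib_right of_real_quat_commute mult.assoc)
    then have "i * j = - (i * j)"
      using anticommute w by metis
    then have "2 *\<^sub>R (i * j) = 0"
      by (simp only: eq_neg_iff_add_eq_0 scaleR_2)
    then have "i * j = 0"
      by (simp only: scaleR_eq_0_iff) simp
    then show False
      using i_unit j_unit by (auto simp: imag_units_def)
  qed
  with assms show "u = 0"
    by (simp add: emb_eq_0_iff[OF i_unit])
qed

lemma split_coords_eqI:
  assumes "q = emb i u + emb i v * j"
  shows "split_coords i j q = (u, v)"
  unfolding split_coords_def
proof (rule the_equality)
  fix p assume "q = emb i (fst p) + emb i (snd p) * j"
  then have "emb i (fst p - u) + emb i (snd p - v) * j = 0"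
    using assms by (simp add: emb_diff algebra_simps)
  then show "p = (u, v)"
    by (auto dest: frame_independent simp: prod_eq_iff)
qed (use assms in simp)

text \<open>Conjugation by \<open>i\<close> is an involution. The component of \<open>q\<close> fixed by it commutes with \<open>i\<close> and so is complex;
  the component on which it is \<open>- 1\<close> anticommutes with \<open>i\<close> and becomes complex after multiplication by
  \<open>j\<close>.\<close>
lemma frame_decomposition:
  "q = emb i (fst (split_coords i j q)) + emb i (snd (split_coords i j q)) * j"
proof -
  define q1 where "q1 = (1/2) *\<^sub>R (q - i * q * i)"
  define q2 where "q2 = (1/2) *\<^sub>R (q + i * q * i)"
  have ii: "i * (i * x) = - x" "j * (j * x) = - x" for x
    using i_unit j_unit by (simp_all add: imag_unit_mult_self flip: mult.assoc)
  note sq = imag_unit_mult_self[OF i_unit] imag_unit_mult_self[OF j_unit]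
  have q1: "q1 * i = i * q1" and q2: "q2 * i = - (i * q2)"
    by (simp_all add: q1_def q2_def algebra_simps ii sq)
  then obtain u where u: "q1 = emb i u"
    using commutes_imag_unit_imp_emb[OF i_unit] by blast
  have "q2 * j * i = i * (q2 * j)"
  proof -
    have "q2 * j * i = - (q2 * i * j)"
      by (simp add: mult.assoc anticommute)
    also have "\<dots> = i * (q2 * j)"
      by (simp add: q2 mult.assoc)
    finally show ?thesis .
  qed
  then obtain v where v: "q2 * j = emb i v"
    using commutes_imag_unit_imp_emb[OF i_unit] by blast
  have "q = q1 + q2"
    by (simp add: q1_def q2_def flip: scaleR_add_right)
  also have "q2 = emb i (- v) * j"
    using v by (simp add: emb_minus sq mult.assoc flip: v)
  finally have "q = emb i u + emb i (- v) * j"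
    by (simp add: u)
  with split_coords_eqI[OF this] show ?thesis by simp
qed

lemma split_coords_add:
  "split_coords i j (p + q) =
    (fst (split_coords i j p) + fst (split_coords i j q), snd (split_coords i j p) + snd (split_coords i j q))"
  by (rule split_coords_eqI, subst (1) frame_decomposition[of p], subst (1) frame_decomposition[of q])
     (simp add: emb_add algebra_simps)

lemma split_coords_mult:
  "split_coords i j (p * q) =
    (fst (split_coords i j p) * fst (split_coords i j q) - snd (split_coords i j p) * cnj (snd (split_coords i j q)),
     fst (split_coords i j p) * snd (split_coords i j q) + snd (split_coords i j p) * cnj (fst (split_coords i j q)))"
proof (rule split_coords_eqI)
  obtain a b c d where ab: "split_coords i j p = (a, b)" and cd: "split_coords i j q = (c, d)"
    by (metis surj_pair)
  have "p * q = (emb i a + emb i b * j) * (emb i c + emb i d * j)"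
    using frame_decomposition[of p] frame_decomposition[of q] by (simp add: ab cd)
  also have "\<dots> = emb i a * emb i c + emb i a * (emb i d * j) + emb i b * (j * emb i c)
      + emb i b * (j * emb i d * j)"
    by (simp add: algebra_simps)
  also have "\<dots> = emb i (a * c - b * cnj d) + emb i (a * d + b * cnj c) * j"
    by (simp add: j_emb emb_mult[OF i_unit] emb_add emb_diff mult.assoc distrib_right
        imag_unit_mult_self[OF j_unit])
  finally show "p * q = emb i (fst (split_coords i j p) * fst (split_coords i j q)
        - snd (split_coords i j p) * cnj (snd (split_coords i j q))) +
      emb i (fst (split_coords i j p) * snd (split_coords i j q)
        + snd (split_coords i j p) * cnj (fst (split_coords i j q))) * j"
    by (simp add: ab cd)
qed

lemma split_coords_emb: "split_coords i j (emb i z) = (z, 0)"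
  by (rule split_coords_eqI) simp

lemma split_coords_of_real: "split_coords i j (of_real x) = (of_real x, 0)"
  using split_coords_emb[of "of_real x"] by simp

lemma split_coords_inj: "split_coords i j p = split_coords i j q \<Longrightarrow> p = q"
  by (metis frame_decomposition)

lemma split_coords_sum:
  "split_coords i j (\<Sum>m\<in>S. f m) =
    (\<Sum>m\<in>S. fst (split_coords i j (f m)), \<Sum>m\<in>S. snd (split_coords i j (f m)))"
  using split_coords_of_real[of 0]
  by (induction S rule: infinite_finite_induct) (simp_all add: split_coords_add)

lemma qmat_add: "qmat i j (p + q) = qmat i j p + qmat i j q"
  by (simp add: qmat_def split_coords_add vec_eq_iff forall_2)

text \<open>In the coordinates \<open>(u, v)\<close>, the matrix of \<open>q\<close> describes right multiplication by \<open>q\<close>, and right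
  multiplication by \<open>p q\<close> is that by \<open>p\<close> followed by that by \<open>q\<close>.\<close>
lemma qmat_mult: "qmat i j (p * q) = qmat i j q ** qmat i j p"
  by (simp add: qmat_def split_coords_mult vec_eq_iff forall_2 matrix_matrix_mult_def sum_2 algebra_simps)

lemma qmat_of_real: "qmat i j (of_real x) = mat (of_real x)"
  by (simp add: qmat_def split_coords_of_real vec_eq_iff forall_2 mat_def)

lemma qmat_0 [simp]: "qmat i j 0 = 0"
  by (simp add: qmat_def split_coords_of_real[of 0, simplified] vec_eq_iff forall_2)

lemma qmat_1 [simp]: "qmat i j 1 = mat 1"
  using qmat_of_real[of 1] by simp

lemma qmat_eq_iff [simp]: "qmat i j p = qmat i j q \<longleftrightarrow> p = q"
  by (auto simp: qmat_def vec_eq_iff forall_2 intro: split_coords_inj prod_eqI)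

lemma quat_blocks_eq_range: "quat_blocks = range (qmat i j)"
proof
  show "quat_blocks \<subseteq> range (qmat i j)"
  proof
    fix M assume "M \<in> quat_blocks"
    then obtain z w where "M = vector [vector [z, - cnj w], vector [w, cnj z]]"
      by (auto simp: quat_blocks_def)
    then have "M = qmat i j (emb i z + emb i w * j)"
      by (simp add: qmat_def split_coords_eqI[OF refl])
    then show "M \<in> range (qmat i j)" by blast
  qed
qed (auto simp: qmat_def quat_blocks_def)

lemma matrix_inv_qmat: "a \<noteq> 0 \<Longrightarrow> matrix_inv (qmat i j a) = qmat i j (inverse a)"
  by (rule matrix_inv_eqI) (simp_all flip: qmat_mult)

text \<open>The entries with a hat are evaluated at \<open>cnj z\<close> and then conjugated, so the powers of \<open>z\<close> come out of
  the second column exactly as they do out of the first one.\<close>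
lemma Phi_qpoly:
  assumes \<Omega>: "symmetric_slice_domain \<Omega>" and z: "z \<in> slice \<Omega> i"
  shows "Phi i j (qpoly \<Omega> n b) z = (\<Sum>m\<le>n. mat (z ^ m) ** qmat i j (b m))"
proof -
  have coords: "split_coords i j (qpoly \<Omega> n b (emb i w)) =
      (\<Sum>m\<le>n. w ^ m * fst (split_coords i j (b m)), \<Sum>m\<le>n. w ^ m * snd (split_coords i j (b m)))"
    if "w \<in> slice \<Omega> i" for w
    using that by (simp add: slice_def qpoly_def split_coords_sum split_coords_mult split_coords_emb
        flip: emb_power[OF i_unit])
  have "cnj z \<in> slice \<Omega> i"
    using \<Omega> i_unit z by (rule symmetric_slice_domain_cnj)
  with z show ?thesis
    by (simp add: Phi_def split_g_def split_h_def hat_def coords vec_eq_iff forall_2 sum_2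
        matrix_matrix_mult_def mat_def qmat_def sum_negf)
qed

lemma SR_eqI_Phi:
  assumes \<Omega>: "symmetric_slice_domain \<Omega>" and "F \<in> SR \<Omega>" "G \<in> SR \<Omega>"
    and eq: "\<And>z. z \<in> slice \<Omega> i \<Longrightarrow> Phi i j F z = Phi i j G z"
  shows "F = G"
proof (rule SR_eqI_real[OF assms(1-3)])
  fix x :: real assume "of_real x \<in> \<Omega>"
  then have "Phi i j F (of_real x) = Phi i j G (of_real x)"
    by (intro eq) (simp add: slice_def)
  then have "split_coords i j (F (of_real x)) = split_coords i j (G (of_real x))"
    by (simp add: Phi_def split_g_def split_h_def vec_eq_iff forall_2 prod_eq_iff)
  then show "F (of_real x) = G (of_real x)"
    by (rule split_coords_inj)
qed

section \<open>The group of block triangular matrices\<close>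

definition bmat :: "quat \<Rightarrow> quat \<Rightarrow> quat \<Rightarrow> complex^4^4" where
  "bmat a c d = lower_blocks (qmat i j a) (qmat i j c) (qmat i j d)"

lemma bmat_mult: "bmat a c d ** bmat a' c' d' = bmat (a' * a) (a' * c + c' * d) (d' * d)"
  by (simp add: bmat_def lower_blocks_mult qmat_mult qmat_add)

lemma bmat_real: "bmat (of_real r) 0 (of_real r) = mat (of_real r)"
  by (simp add: bmat_def qmat_of_real lower_blocks_mat)

lemma bmat_eq_iff: "bmat a c d = bmat a' c' d' \<longleftrightarrow> a = a' \<and> c = c' \<and> d = d'"
  by (metis bmat_def blocks_lower_blocks qmat_eq_iff)

lemma bmat_inverse:
  assumes "a \<noteq> 0" "d \<noteq> 0"
  shows "bmat (inverse a) (- (inverse a * c * inverse d)) (inverse d) ** bmat a c d = mat 1"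
    "bmat a c d ** bmat (inverse a) (- (inverse a * c * inverse d)) (inverse d) = mat 1"
  using assms bmat_real[of 1] by (simp_all add: bmat_mult mult.assoc flip: mult.assoc[of a "inverse a"])

text \<open>Block triangular matrices are invertible exactly when both diagonal blocks are, and a nonzero
  quaternion is invertible. In this way the computations in the group reduce to quaternion arithmetic
  with triples \<open>(a, c, d)\<close>.\<close>
lemma carrier_B_H: "carrier B_H = {bmat a c d | a c d. a \<noteq> 0 \<and> d \<noteq> 0}"
proof (intro equalityI subsetI)
  fix T assume "T \<in> carrier B_H"
  then have "invertible T" "block_B T = 0"
      "block_A T \<in> range (qmat i j)" "block_C T \<in> range (qmat i j)" "block_D T \<in> range (qmat i j)"
    by (auto simp: B_H_def quat_blocks_eq_range)
  then obtain a c d where T: "T = bmat a c d"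
    by (metis bmat_def lower_blocks_of_blocks rangeE)
  obtain S where S: "T ** S = mat 1" "S ** T = mat 1"
    using \<open>invertible T\<close> by (auto simp: invertible_def)
  have "a \<noteq> 0"
  proof
    assume "a = 0"
    then have "(T ** S) $ 1 $ 1 = 0"
      by (simp add: T bmat_def lower_blocks_def matrix_matrix_mult_def vector_4 sum_4)
    then show False by (simp add: S mat_def)
  qed
  moreover have "d \<noteq> 0"
  proof
    assume "d = 0"
    then have "(S ** T) $ 4 $ 4 = 0"
      by (simp add: T bmat_def lower_blocks_def matrix_matrix_mult_def vector_4 sum_4)
    then show False by (simp add: S mat_def)
  qed
  ultimately show "T \<in> {bmat a c d | a c d. a \<noteq> 0 \<and> d \<noteq> 0}"
    using T by blast
next
  fix T assume "T \<in> {bmat a c d | a c d. a \<noteq> 0 \<and> d \<noteq> 0}"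
  then obtain a c d where T: "T = bmat a c d" "a \<noteq> 0" "d \<noteq> 0" by blast
  then have "invertible T"
    unfolding invertible_def using bmat_inverse by blast
  then show "T \<in> carrier B_H"
    by (simp add: T(1) B_H_def quat_blocks_eq_range bmat_def)
qed

lemma bmat_in_carrier: "a \<noteq> 0 \<Longrightarrow> d \<noteq> 0 \<Longrightarrow> bmat a c d \<in> carrier B_H"
  unfolding carrier_B_H by blast

lemma group_B_H: "group B_H"
proof (rule groupI)
  fix S T assume "S \<in> carrier B_H" "T \<in> carrier B_H"
  then show "S \<otimes>\<^bsub>B_H\<^esub> T \<in> carrier B_H"
    unfolding carrier_B_H by (auto simp: B_H_def bmat_mult bmat_eq_iff)
next
  show "\<one>\<^bsub>B_H\<^esub> \<in> carrier B_H"
    using bmat_real[of 1] bmat_in_carrier[of 1 1 0] by (simp add: B_H_def)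
next
  fix T assume "T \<in> carrier B_H"
  then obtain a c d where "T = bmat a c d" "a \<noteq> 0" "d \<noteq> 0"
    unfolding carrier_B_H by blast
  then show "\<exists>S\<in>carrier B_H. S \<otimes>\<^bsub>B_H\<^esub> T = \<one>\<^bsub>B_H\<^esub>"
    by (intro bexI[OF _ bmat_in_carrier[of "inverse a" "inverse d" "- (inverse a * c * inverse d)"]])
       (simp_all add: B_H_def bmat_inverse)
qed (simp_all add: B_H_def matrix_mul_assoc)

lemma real_scalars_normal: "real_scalars \<lhd> B_H"
proof -
  interpret group B_H by (rule group_B_H)
  have scal: "real_scalars = {bmat (of_real r) 0 (of_real r) | r. r \<noteq> 0}"
    by (simp add: real_scalars_def bmat_real)
  have sub: "real_scalars \<subseteq> carrier B_H"
    unfolding scal carrier_B_H by fastforce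
  have "subgroup real_scalars B_H"
  proof (rule subgroupI)
    fix S T assume "S \<in> real_scalars" "T \<in> real_scalars"
    then obtain r s where "S = mat (of_real r)" "T = mat (of_real s)" "r \<noteq> 0" "s \<noteq> 0"
      by (auto simp: real_scalars_def)
    then show "S \<otimes>\<^bsub>B_H\<^esub> T \<in> real_scalars"
      unfolding scal by (auto simp: B_H_def bmat_mult bmat_eq_iff simp flip: bmat_real of_real_mult
          intro!: exI[of _ "r * s"])
  next
    fix S assume "S \<in> real_scalars"
    then obtain r where r: "S = bmat (of_real r) 0 (of_real r)" "r \<noteq> 0"
      by (auto simp: scal)
    have "inv\<^bsub>B_H\<^esub> S = bmat (of_real (inverse r)) 0 (of_real (inverse r))"
      using r bmat_inverse(1)[of "of_real r" "of_real r" 0]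
      by (intro inv_equality) (auto simp: carrier_B_H bmat_eq_iff, auto simp: B_H_def)
    then show "inv\<^bsub>B_H\<^esub> S \<in> real_scalars"
      using r(2) unfolding scal by (metis (mono_tags, lifting) inverse_nonzero_iff_nonzero mem_Collect_eq)
  qed (use sub in \<open>auto simp: real_scalars_def intro!: exI[of _ 1]\<close>)
  moreover have "T \<otimes>\<^bsub>B_H\<^esub> S \<otimes>\<^bsub>B_H\<^esub> inv\<^bsub>B_H\<^esub> T \<in> real_scalars"
    if "T \<in> carrier B_H" "S \<in> real_scalars" for S T
  proof -
    have "T \<otimes>\<^bsub>B_H\<^esub> S = S \<otimes>\<^bsub>B_H\<^esub> T"
      using that(2) by (auto simp: real_scalars_def B_H_def mat_mult_commute)
    then show ?thesis
      using that sub by (simp add: m_assoc subsetD)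
  qed
  ultimately show ?thesis
    by (rule normal_invI)
qed

definition gcoset :: "quat \<Rightarrow> quat \<Rightarrow> quat \<Rightarrow> (complex^4^4) set" where
  "gcoset a c d = real_scalars #>\<^bsub>B_H\<^esub> bmat a c d"

lemma gcoset_eq: "gcoset a c d = {bmat (of_real r * a) (of_real r * c) (of_real r * d) | r. r \<noteq> 0}"
proof -
  have "mat (of_real r) ** bmat a c d = bmat (of_real r * a) (of_real r * c) (of_real r * d)" for r
    by (simp add: bmat_mult of_real_quat_commute flip: bmat_real)
  then show ?thesis
    by (auto simp: gcoset_def r_coset_def real_scalars_def B_H_def)
qed

lemma carrier_Gamma_univ: "carrier Gamma_univ = {gcoset a c d | a c d. a \<noteq> 0 \<and> d \<noteq> 0}"
  by (auto simp: Gamma_univ_def carrier_FactGroup carrier_B_H gcoset_def)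

lemma gcoset_mult:
  assumes "a \<noteq> 0" "d \<noteq> 0" "a' \<noteq> 0" "d' \<noteq> 0"
  shows "gcoset a c d \<otimes>\<^bsub>Gamma_univ\<^esub> gcoset a' c' d' = gcoset (a' * a) (a' * c + c' * d) (d' * d)"
proof -
  from normal.rcos_sum[OF real_scalars_normal bmat_in_carrier[OF assms(1,2)]
      bmat_in_carrier[OF assms(3,4)]] show ?thesis
    by (simp add: Gamma_univ_def FactGroup_def gcoset_def B_H_def bmat_mult)
qed

lemma group_Gamma_univ: "group Gamma_univ"
  unfolding Gamma_univ_def using real_scalars_normal by (rule normal.factorgroup_is_group)

section \<open>The action on polynomials\<close>

lemma action_on_sum:
  "(qmat i j c + qmat i j d ** (\<Sum>m\<le>n. mat (w m) ** qmat i j (b m))) ** qmat i j a =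
   (\<Sum>m\<le>n. mat (w m) ** qmat i j (a * (c * (if m = 0 then 1 else 0) + b m * d)))"
  if "w 0 = 1" for w :: "nat \<Rightarrow> complex"
proof (induction n)
  case 0
  then show ?case
    using that by (simp add: qmat_mult qmat_add)
next
  case (Suc n)
  have "qmat i j d ** (mat (w (Suc n)) ** qmat i j (b (Suc n))) ** qmat i j a
      = mat (w (Suc n)) ** qmat i j (a * (b (Suc n) * d))"
    by (simp add: qmat_mult matrix_mul_assoc mat_mult_commute[of "w (Suc n)" "qmat i j d"])
  then show ?case
    by (simp add: Suc[symmetric] matrix_add_ldistrib matrix_add_rdistrib)
qed

text \<open>The polynomial on the right satisfies the defining equation for every representative of the class,
  since a common real factor of \<open>a\<close>, \<open>c\<close> and \<open>d\<close> cancels; the identity principle shows that it is the only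
  such slice regular function.\<close>
lemma gact_qpoly:
  assumes \<Omega>: "symmetric_slice_domain \<Omega>" and a: "a \<noteq> 0" and d: "d \<noteq> 0"
  shows "gact i j \<Omega> (gcoset a c d) (qpoly \<Omega> n b) =
    qpoly \<Omega> n (\<lambda>m. inverse a * (c * (if m = 0 then 1 else 0) + b m * d))" (is "_ = qpoly \<Omega> n ?b")
  unfolding gact_def
proof (rule the_equality)
  have eq: "Phi i j (qpoly \<Omega> n ?b) z =
      (block_C T + block_D T ** Phi i j (qpoly \<Omega> n b) z) ** matrix_inv (block_A T)"
    if T: "T \<in> gcoset a c d" and z: "z \<in> slice \<Omega> i" for T z
  proof -
    obtain r where r: "r \<noteq> 0" "T = bmat (of_real r * a) (of_real r * c) (of_real r * d)"
      using T unfolding gcoset_eq by blast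
    have unscale: "inverse (of_real r * a) * (of_real r * c * e + b m * (of_real r * d))
        = inverse a * (c * e + b m * d)" for e m
    proof -
      have "of_real r * c * e + b m * (of_real r * d) = of_real r * (c * e + b m * d)"
        by (simp add: scaleR_add_right flip: scaleR_conv_of_real)
      moreover have "inverse (of_real r * a) * (of_real r * x) = inverse a * x" for x
      proof -
        have "inverse (of_real r * a) = inverse a * inverse (of_real r)"
          using r(1) a by (intro nonzero_inverse_mult_distrib) auto
        moreover have "inverse (of_real r) * (of_real r * x) = x"
          using r(1) by (simp add: mult.assoc[symmetric] del: of_real_inverse)
        ultimately show ?thesis
          by (simp only: mult.assoc)
      qed
      ultimately show ?thesis
        by (simp only:)
    qed
    have "matrix_inv (block_A T) = qmat i j (inverse (of_real r * a))"
      unfolding r(2) bmat_def blocks_lower_blocks using r(1) a by (intro matrix_inv_qmat) auto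
    then have "(block_C T + block_D T ** Phi i j (qpoly \<Omega> n b) z) ** matrix_inv (block_A T) =
      (qmat i j (of_real r * c) + qmat i j (of_real r * d) **
        (\<Sum>m\<le>n. mat (z ^ m) ** qmat i j (b m))) ** qmat i j (inverse (of_real r * a))"
      by (simp only: r(2) bmat_def blocks_lower_blocks Phi_qpoly[OF \<Omega> z])
    also have "\<dots> = (\<Sum>m\<le>n. mat (z ^ m) ** qmat i j (?b m))"
      by (simp only: action_on_sum power_0 unscale)
    finally show ?thesis
      by (simp only: Phi_qpoly[OF \<Omega> z])
  qed
  show *: "qpoly \<Omega> n ?b \<in> SR \<Omega> \<and> (\<forall>T\<in>gcoset a c d. \<forall>z\<in>slice \<Omega> i. Phi i j (qpoly \<Omega> n ?b) z =
      (block_C T + block_D T ** Phi i j (qpoly \<Omega> n b) z) ** matrix_inv (block_A T))"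
    using eq qpoly_in_SR[OF \<Omega>] by blast
  have "bmat a c d \<in> gcoset a c d"
    unfolding gcoset_eq by (auto intro!: exI[of _ 1])
  then show "F = qpoly \<Omega> n ?b" if "F \<in> SR \<Omega> \<and> (\<forall>T\<in>gcoset a c d. \<forall>z\<in>slice \<Omega> i. Phi i j F z =
      (block_C T + block_D T ** Phi i j (qpoly \<Omega> n b) z) ** matrix_inv (block_A T))" for F
    using that * by (intro SR_eqI_Phi[OF \<Omega>]) auto
qed

section \<open>The orbits and the stabiliser of the monic polynomials\<close>

text \<open>The constant coefficient of the image is \<open>a\<^sup>-\<^sup>1 c\<close> and the leading one is \<open>a\<^sup>-\<^sup>1 d\<close>.\<close>
lemma gact_npoly_eq_npoly_iff:
  assumes \<Omega>: "symmetric_slice_domain \<Omega>" and n: "n \<ge> 1" and "a \<noteq> 0" "d \<noteq> 0"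
  shows "gact i j \<Omega> (gcoset a c d) (npoly \<Omega> n b) = npoly \<Omega> n b' \<longleftrightarrow>
    c = 0 \<and> d = a \<and> (\<forall>m\<in>{1..<n}. b' m = inverse a * b m * a)"
proof
  assume "gact i j \<Omega> (gcoset a c d) (npoly \<Omega> n b) = npoly \<Omega> n b'"
  then have *: "inverse a * (c * (if m = 0 then 1 else 0) + (if m = 0 then 0 else if m = n then 1 else b m) * d)
      = (if m = 0 then 0 else if m = n then 1 else b' m)" if "m \<le> n" for m
    using that assms by (simp add: npoly_eq_qpoly gact_qpoly qpoly_eq_iff)
  have "c = 0" using *[of 0] \<open>a \<noteq> 0\<close> by simp
  moreover have "inverse a * d = 1" using *[of n] n by simp
  then have "d = a"
    using \<open>a \<noteq> 0\<close> by (metis inverse_inverse_eq inverse_unique)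
  moreover have "b' m = inverse a * b m * a" if "m \<in> {1..<n}" for m
    using *[of m] that \<open>d = a\<close> by (simp add: mult.assoc)
  ultimately show "c = 0 \<and> d = a \<and> (\<forall>m\<in>{1..<n}. b' m = inverse a * b m * a)" by blast
next
  assume "c = 0 \<and> d = a \<and> (\<forall>m\<in>{1..<n}. b' m = inverse a * b m * a)"
  then show "gact i j \<Omega> (gcoset a c d) (npoly \<Omega> n b) = npoly \<Omega> n b'"
    using assms by (auto simp: npoly_eq_qpoly gact_qpoly qpoly_eq_iff mult.assoc)
qed

text \<open>The inverses make the map a homomorphism, since \<open>qmat\<close> reverses products.\<close>
definition conj_coset :: "quat \<Rightarrow> (complex^4^4) set" where
  "conj_coset \<eta> = gcoset (inverse \<eta>) 0 (inverse \<eta>)"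

lemma gact_conj_coset:
  assumes "symmetric_slice_domain \<Omega>" "n \<ge> 1" "\<eta> \<noteq> 0"
  shows "gact i j \<Omega> (conj_coset \<eta>) (npoly \<Omega> n b) = npoly \<Omega> n (\<lambda>m. \<eta> * b m * inverse \<eta>)"
  unfolding conj_coset_def using assms by (subst gact_npoly_eq_npoly_iff) auto

lemma orbit_npoly_iff:
  assumes "symmetric_slice_domain \<Omega>" "n \<ge> 1"
  shows "npoly \<Omega> n c \<in> orbit Gamma_univ (gact i j \<Omega>) (npoly \<Omega> n b) \<longleftrightarrow>
    (\<exists>\<eta>. \<eta> \<noteq> 0 \<and> (\<forall>m\<in>{1..<n}. c m = \<eta> * b m * inverse \<eta>))"
proof
  assume "npoly \<Omega> n c \<in> orbit Gamma_univ (gact i j \<Omega>) (npoly \<Omega> n b)"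
  then obtain a c' d where "a \<noteq> 0" "d \<noteq> 0"
      "gact i j \<Omega> (gcoset a c' d) (npoly \<Omega> n b) = npoly \<Omega> n c"
    by (auto simp: orbit_def carrier_Gamma_univ)
  then show "\<exists>\<eta>. \<eta> \<noteq> 0 \<and> (\<forall>m\<in>{1..<n}. c m = \<eta> * b m * inverse \<eta>)"
    using assms by (intro exI[of _ "inverse a"]) (simp add: gact_npoly_eq_npoly_iff)
next
  assume "\<exists>\<eta>. \<eta> \<noteq> 0 \<and> (\<forall>m\<in>{1..<n}. c m = \<eta> * b m * inverse \<eta>)"
  then obtain \<eta> where \<eta>: "\<eta> \<noteq> 0" "\<forall>m\<in>{1..<n}. c m = \<eta> * b m * inverse \<eta>" by blast
  then have "npoly \<Omega> n c = gact i j \<Omega> (conj_coset \<eta>) (npoly \<Omega> n b)"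
    using assms by (simp add: gact_conj_coset npoly_eq_iff)
  moreover have "conj_coset \<eta> \<in> carrier Gamma_univ"
    using \<eta>(1) unfolding carrier_Gamma_univ conj_coset_def by fastforce
  ultimately show "npoly \<Omega> n c \<in> orbit Gamma_univ (gact i j \<Omega>) (npoly \<Omega> n b)"
    by (auto simp: orbit_def)
qed

lemma conj_coset_group_hom: "group_hom H_units Gamma_univ conj_coset"
proof (intro group_hom.intro group_hom_axioms.intro group_H_units group_Gamma_univ homI)
  fix \<eta> \<xi> assume "\<eta> \<in> carrier H_units" "\<xi> \<in> carrier H_units"
  then have "\<eta> \<noteq> 0" "\<xi> \<noteq> 0" by (auto simp: H_units_def)
  then show "conj_coset (\<eta> \<otimes>\<^bsub>H_units\<^esub> \<xi>) = conj_coset \<eta> \<otimes>\<^bsub>Gamma_univ\<^esub> conj_coset \<xi>"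
    by (simp add: conj_coset_def H_units_def gcoset_mult nonzero_inverse_mult_distrib)
  show "conj_coset \<eta> \<in> carrier Gamma_univ"
    using \<open>\<eta> \<noteq> 0\<close> unfolding carrier_Gamma_univ conj_coset_def by fastforce
qed

lemma kernel_conj_coset: "kernel H_units Gamma_univ conj_coset = R_units"
proof -
  have one: "\<one>\<^bsub>Gamma_univ\<^esub> = gcoset 1 0 1"
    using group_hom.hom_one[OF conj_coset_group_hom] by (simp add: H_units_def conj_coset_def)
  have "conj_coset \<eta> = gcoset 1 0 1 \<longleftrightarrow> \<eta> \<in> \<real>" if "\<eta> \<noteq> 0" for \<eta>
  proof
    assume "conj_coset \<eta> = gcoset 1 0 1"
    moreover have "bmat (inverse \<eta>) 0 (inverse \<eta>) \<in> conj_coset \<eta>"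
      unfolding conj_coset_def gcoset_eq by (auto intro!: exI[of _ 1])
    ultimately obtain r where "inverse \<eta> = of_real r"
      by (auto simp: gcoset_eq bmat_eq_iff)
    then show "\<eta> \<in> \<real>"
      by (metis Reals_inverse Reals_of_real inverse_inverse_eq)
  next
    assume "\<eta> \<in> \<real>"
    then obtain r where r: "\<eta> = of_real r" by (rule Reals_cases)
    have "r \<noteq> 0" using r that by auto
    have "conj_coset \<eta> = {bmat (of_real s) 0 (of_real s) | s. s \<noteq> 0}"
    proof (intro equalityI subsetI)
      fix T assume "T \<in> {bmat (of_real s) 0 (of_real s) | s. s \<noteq> 0}"
      then obtain s where "T = bmat (of_real s) 0 (of_real s)" "s \<noteq> 0" by blast
      then show "T \<in> conj_coset \<eta>"
        using \<open>r \<noteq> 0\<close> unfolding conj_coset_def gcoset_eq r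
        by (auto intro!: exI[of _ "s * r"] simp: mult.assoc)
    next
      fix T assume "T \<in> conj_coset \<eta>"
      then obtain s where "T = bmat (of_real (s * inverse r)) 0 (of_real (s * inverse r))" "s \<noteq> 0"
        unfolding conj_coset_def gcoset_eq r by auto
      then show "T \<in> {bmat (of_real s) 0 (of_real s) | s. s \<noteq> 0}"
        using \<open>r \<noteq> 0\<close> by (auto simp del: of_real_mult)
    qed
    then show "conj_coset \<eta> = gcoset 1 0 1"
      by (simp add: gcoset_eq)
  qed
  then show ?thesis
    by (auto simp: kernel_def H_units_def R_units_def one)
qed

text \<open>One polynomial whose image is again monic without constant term already forces \<open>c = 0\<close> and
  \<open>d = a\<close>.\<close>
lemma stab_N_eq_range_conj_coset:
  assumes \<Omega>: "symmetric_slice_domain \<Omega>" and n: "n \<ge> 1"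
  shows "conj_coset ` carrier H_units = stab_N i j \<Omega> n"
proof (intro equalityI subsetI)
  fix X assume "X \<in> conj_coset ` carrier H_units"
  then obtain \<eta> where \<eta>: "\<eta> \<noteq> 0" and X: "X = conj_coset \<eta>"
    by (auto simp: H_units_def)
  have "X \<in> carrier Gamma_univ"
    using \<eta> X unfolding carrier_Gamma_univ conj_coset_def by fastforce
  moreover have "gact i j \<Omega> X ` Npolys \<Omega> n \<subseteq> Npolys \<Omega> n"
    using gact_conj_coset[OF \<Omega> n \<eta>] by (auto simp: Npolys_def X)
  moreover have "npoly \<Omega> n b \<in> gact i j \<Omega> X ` Npolys \<Omega> n" for b
  proof -
    have "npoly \<Omega> n b = gact i j \<Omega> X (npoly \<Omega> n (\<lambda>m. inverse \<eta> * b m * \<eta>))"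
      using \<eta> gact_conj_coset[OF \<Omega> n \<eta>, of "\<lambda>m. inverse \<eta> * b m * \<eta>"]
      by (simp add: X mult.assoc) (simp flip: mult.assoc)
    then show ?thesis
      by (auto simp: Npolys_def)
  qed
  ultimately show "X \<in> stab_N i j \<Omega> n"
    unfolding stab_N_def Npolys_def by blast
next
  fix X assume "X \<in> stab_N i j \<Omega> n"
  then obtain a c d where X: "X = gcoset a c d" "a \<noteq> 0" "d \<noteq> 0"
      and img: "gact i j \<Omega> X ` Npolys \<Omega> n = Npolys \<Omega> n"
    by (auto simp: stab_N_def carrier_Gamma_univ)
  have "npoly \<Omega> n (\<lambda>m. 0) \<in> Npolys \<Omega> n"
    by (auto simp: Npolys_def)
  then have "gact i j \<Omega> X (npoly \<Omega> n (\<lambda>m. 0)) \<in> Npolys \<Omega> n"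
    using img by blast
  then obtain b' where "gact i j \<Omega> X (npoly \<Omega> n (\<lambda>m. 0)) = npoly \<Omega> n b'"
    by (auto simp: Npolys_def)
  then have "X = conj_coset (inverse a)"
    using X \<Omega> n by (simp add: gact_npoly_eq_npoly_iff conj_coset_def)
  then show "X \<in> conj_coset ` carrier H_units"
    using X(2) by (auto simp: H_units_def)
qed

lemma PH_iso_stab_N:
  assumes \<Omega>: "symmetric_slice_domain \<Omega>" and n: "n \<ge> 1"
  obtains \<psi> where "\<psi> \<in> iso PH (Gamma_univ\<lparr>carrier := stab_N i j \<Omega> n\<rparr>)"
    "\<And>\<eta>. \<eta> \<noteq> 0 \<Longrightarrow> \<psi> (R_units #>\<^bsub>H_units\<^esub> \<eta>) = conj_coset \<eta>"
proof
  let ?S = "Gamma_univ\<lparr>carrier := stab_N i j \<Omega> n\<rparr>"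
  let ?\<psi> = "\<lambda>X. the_elem (conj_coset ` X)"
  interpret C: group_hom H_units Gamma_univ conj_coset
    by (rule conj_coset_group_hom)
  note img = stab_N_eq_range_conj_coset[OF assms]
  have "group ?S"
    using subgroup.subgroup_is_group[OF C.img_is_subgroup group_Gamma_univ] by (simp add: img)
  moreover have "conj_coset \<in> hom H_units ?S"
    using C.homh img by (auto simp: hom_def)
  ultimately interpret S: group_hom H_units ?S conj_coset
    by (intro group_hom.intro group_hom_axioms.intro group_H_units)
  have "kernel H_units ?S conj_coset = R_units"
    using kernel_conj_coset by (simp add: kernel_def)
  then show "?\<psi> \<in> iso PH ?S"
    using S.FactGroup_iso_set img by (simp add: PH_def)
  show "?\<psi> (R_units #>\<^bsub>H_units\<^esub> \<eta>) = conj_coset \<eta>" if "\<eta> \<noteq> 0" for \<eta>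
  proof -
    have \<eta>: "\<eta> \<in> carrier H_units" using that by (simp add: H_units_def)
    have "conj_coset (r \<otimes>\<^bsub>H_units\<^esub> \<eta>) = conj_coset \<eta>" if "r \<in> R_units" for r
      using that \<eta> by (simp add: kernel_conj_coset[symmetric] kernel_def)
    moreover have "1 \<in> R_units" by (simp add: R_units_def)
    ultimately have "conj_coset ` (R_units #>\<^bsub>H_units\<^esub> \<eta>) = {conj_coset \<eta>}"
      by (auto simp: r_coset_def)
    then show ?thesis by simp
  qed
qed

end

theorem corollary5p22:
  fixes i j :: quat and \<Omega> :: "quat set" and n :: nat
  assumes "i \<in> imag_units" and "j \<in> imag_units" and "i * j = - (j * i)"
    and "symmetric_slice_domain \<Omega>"
    and "n \<ge> 1"
  shows
    "(\<forall>b c :: nat \<Rightarrow> quat.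
        npoly \<Omega> n c \<in> orbit Gamma_univ (gact i j \<Omega>) (npoly \<Omega> n b) \<longleftrightarrow>
        (\<exists>\<eta>. \<eta> \<noteq> 0 \<and> (\<forall>m\<in>{1..<n}. c m = \<eta> * b m * inverse \<eta>))) \<and>
     (\<exists>\<phi>. group_action PH (Npolys \<Omega> n) \<phi> \<and>
        (\<forall>\<eta> b. \<eta> \<noteq> 0 \<longrightarrow>
           \<phi> (R_units #>\<^bsub>H_units\<^esub> \<eta>) (npoly \<Omega> n b) = npoly \<Omega> n (\<lambda>m. \<eta> * b m * inverse \<eta>)) \<and>
        (n \<ge> 2 \<longrightarrow> faithful_action PH (Npolys \<Omega> n) \<phi>) \<and>
        (\<exists>\<psi> \<in> iso PH (Gamma_univ\<lparr>carrier := stab_N i j \<Omega> n\<rparr>).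
           \<forall>X\<in>carrier PH. \<forall>P\<in>Npolys \<Omega> n. gact i j \<Omega> (\<psi> X) P = \<phi> X P)) \<and>
     PH \<cong> SO3"
proof -
  interpret quat_frame i j
    using assms(1-3) by unfold_locales
  note \<Omega>n = assms(4,5)
  obtain \<psi> where iso: "\<psi> \<in> iso PH (Gamma_univ\<lparr>carrier := stab_N i j \<Omega> n\<rparr>)"
    and \<psi>: "\<And>\<eta>. \<eta> \<noteq> 0 \<Longrightarrow> \<psi> (R_units #>\<^bsub>H_units\<^esub> \<eta>) = conj_coset \<eta>"
    using PH_iso_stab_N[OF \<Omega>n] by blast
  define \<phi> where "\<phi> X = restrict (gact i j \<Omega> (\<psi> X)) (Npolys \<Omega> n)" for X
  have \<phi>: "\<phi> (R_units #>\<^bsub>H_units\<^esub> \<eta>) (npoly \<Omega> n b) = npoly \<Omega> n (\<lambda>m. \<eta> * b m * inverse \<eta>)"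
    if "\<eta> \<noteq> 0" for \<eta> b
  proof -
    have "npoly \<Omega> n b \<in> Npolys \<Omega> n" by (auto simp: Npolys_def)
    then show ?thesis
      using that \<Omega>n by (simp add: \<phi>_def \<psi> gact_conj_coset)
  qed
  have ext: "\<phi> X \<in> extensional (Npolys \<Omega> n)" for X
    by (simp add: \<phi>_def)
  have action: "group_action PH (Npolys \<Omega> n) \<phi>"
    by (rule PH_action(1)[OF \<Omega>n]) (auto simp: ext \<phi>)
  have faithful: "n \<ge> 2 \<longrightarrow> faithful_action PH (Npolys \<Omega> n) \<phi>"
    by (intro impI PH_action(2)[OF \<Omega>n]) (auto simp: ext \<phi>)
  have "\<forall>X\<in>carrier PH. \<forall>P\<in>Npolys \<Omega> n. gact i j \<Omega> (\<psi> X) P = \<phi> X P"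
    by (simp add: \<phi>_def)
  then show ?thesis
    by (intro conjI exI[of _ \<phi>] bexI[OF _ iso] allI impI)
      (use orbit_npoly_iff[OF \<Omega>n] PH_iso_SO3 \<phi> action faithful in auto)
qed

end
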